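(* Let $\mathbf{Z}\in\mathbb{R}^6$ be fixed, let $f(\mathbf{X})=\mathbf{dexp}_{\mathbf{X}}\mathbf{Z}$ for $\mathbf{X}=(\mathbf{x},\mathbf{y})\in\mathbb{R}^3\times\mathbb{R}^3$, and let $f^{\mathrm{inv}}(\mathbf{X})=\mathbf{dexp}_{\mathbf{X}}^{-1}\mathbf{Z}$ for those $\mathbf{X}$ with $\beta\neq0$. With $\mathbf{Z}_i:=\mathbf{ad}_{\mathbf{X}}^i\mathbf{Z}$, the Jacobians are $$\frac{\partial f}{\partial\mathbf{X}}=-a_1\mathbf{ad}_{\mathbf{Z}}+a_2\left(\mathbf{ad}_{\mathbf{Z}}\mathbf{ad}_{\mathbf{X}}-2\mathbf{ad}_{\mathbf{X}}\mathbf{ad}_{\mathbf{Z}}\right)-a_3\left(\mathbf{ad}_{\mathbf{X}}^2\mathbf{ad}_{\mathbf{Z}}+\mathbf{ad}_{\mathbf{X}}\mathbf{ad}_{\mathbf{Z}_1}+\mathbf{ad}_{\mathbf{Z}_2}\right)-a_4\left(\mathbf{ad}_{\mathbf{X}}^3\mathbf{ad}_{\mathbf{Z}}+\mathbf{ad}_{\mathbf{X}}\mathbf{ad}_{\mathbf{Z}_2}+\mathbf{ad}_{\mathbf{X}}^2\mathbf{ad}_{\mathbf{Z}_1}+\mathbf{ad}_{\mathbf{Z}_3}\right)+\sum_{i=1}^4\bar a_i\,\mathbf{Z}_i\begin{bmatrix}\mathbf{x}^T&\mathbf{0}\end{bmatrix},$$ $$\frac{\partial f^{\mathrm{inv}}}{\partial\mathbf{X}}=-b_1\mathbf{ad}_{\mathbf{Z}}+b_2\left(\mathbf{ad}_{\mathbf{Z}}\mathbf{ad}_{\mathbf{X}}-2\mathbf{ad}_{\mathbf{X}}\mathbf{ad}_{\mathbf{Z}}\right)-b_4\left(\mathbf{ad}_{\mathbf{X}}^3\mathbf{ad}_{\mathbf{Z}}+\mathbf{ad}_{\mathbf{X}}\mathbf{ad}_{\mathbf{Z}_2}+\mathbf{ad}_{\mathbf{X}}^2\mathbf{ad}_{\mathbf{Z}_1}+\mathbf{ad}_{\mathbf{Z}_3}\right)+\sum_{i=1}^4\bar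 b_i\,\mathbf{Z}_i\begin{bmatrix}\mathbf{x}^T&\mathbf{0}\end{bmatrix}.$$ The limits for $\mathbf{X}\to\mathbf{0}$ are $\frac{\partial f}{\partial\mathbf{X}}(\mathbf{0})=-\frac12\mathbf{ad}_{\mathbf{Z}}$ and $\frac{\partial f^{\mathrm{inv}}}{\partial\mathbf{X}}(\mathbf{0})=\frac12\mathbf{ad}_{\mathbf{Z}}$.
   Context: For $\mathbf{x}\in\mathbb{R}^3$, $\tilde{\mathbf{x}}$ is the skew-symmetric matrix with $\tilde{\mathbf{x}}\mathbf{w}=\mathbf{x}\times\mathbf{w}$. For $\mathbf{X}=(\mathbf{x},\mathbf{y})\in\mathbb{R}^3\times\mathbb{R}^3\cong se(3)$, $\mathbf{ad}_{\mathbf{X}}=\begin{bmatrix}\tilde{\mathbf{x}}&\mathbf{0}\\ \tilde{\mathbf{y}}&\tilde{\mathbf{x}}\end{bmatrix}$. The matrix of the right-trivialized differential of $\exp$ on $SE(3)$ is $\mathbf{dexp}_{\mathbf{X}}=\sum_{i\ge0}\frac1{(i+1)!}\mathbf{ad}_{\mathbf{X}}^i=\mathbf{I}+\sum_{i=1}^4a_i\,\mathbf{ad}_{\mathbf{X}}^i$, and its inverse matrix is $\mathbf{dexp}_{\mathbf{X}}^{-1}=\mathbf{I}+b_1\mathbf{ad}_{\mathbf{X}}+b_2\mathbf{ad}_{\mathbf{X}}^2+b_4\mathbf{ad}_{\mathbf{X}}^4$, with coefficients given as follows. Put $\varphi:=\|\mathbf{x}\|$, $\mathrm{sinc}\,t=\sin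 t/t$, $\alpha:=\mathrm{sinc}\,\varphi$, $\beta:=\mathrm{sinc}^2\frac\varphi2$, $\gamma:=\alpha/\beta$, $\delta:=\frac{1-\alpha}{\varphi^2}$. Then $a_1=\beta-\frac\alpha2$, $a_2=\frac12(5\delta-\frac\beta2)$, $a_3=\frac1{2\varphi^2}(\beta-\alpha)$, $a_4=\frac1{2\varphi^2}(3\delta-\frac\beta2)$; $b_1=-\frac12$, $b_2=\frac1{\varphi^2}(2-\frac{1+3\alpha}{2\beta})$, $b_3=0$, $b_4=\frac1{\varphi^4}(1-\frac{1+\alpha}{2\beta})$; $\bar a_1=\frac14\beta+\frac1{\varphi^2}(\frac52\alpha-2\beta-\frac12)$, $\bar a_2=\frac1{\varphi^2}(\frac74\beta-\frac12\alpha)+\frac{15}{2\varphi^4}(\alpha-1)$, $\bar a_3=\bar a_1/\varphi^2$, $\bar a_4=\bar a_2/\varphi^2$; $\bar b_1=\bar b_3=0$, $\bar b_2=\frac3{4\varphi^2}+\frac1{\varphi^4}\left(\gamma(\frac32+\frac1\beta+3\gamma)-\frac3{2\beta}-4\right)$, $\bar b_4=\frac1{4\varphi^4}+\frac1{\varphi^6}\left(\frac1{2\beta}+\frac32\gamma+\frac\gamma\beta+\gamma^2-4\right)$. These are analytic functions; at $\varphi=0$ they are understood through their (finite) limits. The Jacobian $\frac{\partial f}{\partial\mathbf{X}}$ is the $6\times6$ matrix with $\frac{\partial f}{\partial\mathbf{X}}\mathbf{U}=\frac{d}{dt}f(\mathbf{X}+t\mathbf{U})|_{t=0}$. $\begin{bmatrix}\mathbf{x}^T&\mathbf{0}\end{bmatrix}$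 is the $1\times6$ row vector with last three entries zero. *)

theory Defs
  imports "HOL-Analysis.Analysis" "HOL-Probability.Sinc_Integral"
begin

text \<open>
  The index type \<open>3 + 3\<close> of \<open>real ^ (3 + 3)\<close> is the disjoint sum of two copies of \<open>3\<close>, so that
  \<open>Inl\<close> and \<open>Inr\<close> select the upper and lower blocks of vectors and matrices.
\<close>

type_synonym vec6 = "real ^ (3 + 3)"
type_synonym mat6 = "real ^ (3 + 3) ^ (3 + 3)"

definition upper :: "vec6 \<Rightarrow> real ^ 3" where
  "upper X = (\<chi> i. X $ Inl i)"

definition lower :: "vec6 \<Rightarrow> real ^ 3" where
  "lower X = (\<chi> i. X $ Inr i)"

definition skew :: "real ^ 3 \<Rightarrow> real ^ 3 ^ 3" where
  "skew x = matrix (cross3 x)"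

lemma skew_mult: "skew x *v w = cross3 x w"
proof -
  have "linear (cross3 x)"
    by (rule linearI) (simp_all add: cross_add_right cross_mult_right)
  then show ?thesis
    by (simp add: skew_def matrix_works)
qed

definition ad :: "vec6 \<Rightarrow> mat6" where
  "ad X = (\<chi> i j. case (i, j) of
      (Inl k, Inl l) \<Rightarrow> skew (upper X) $ k $ l
    | (Inl k, Inr l) \<Rightarrow> 0
    | (Inr k, Inl l) \<Rightarrow> skew (lower X) $ k $ l
    | (Inr k, Inr l) \<Rightarrow> skew (upper X) $ k $ l)"

text \<open>The power \<open>^\<close> on vectors and matrices is componentwise, hence a separate matrix power.\<close>

primrec mpow :: "real ^ 'n ^ 'n \<Rightarrow> nat \<Rightarrow> real ^ 'n ^ 'n" where
  "mpow A 0 = mat 1"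
| "mpow A (Suc n) = A ** mpow A n"

definition dexp :: "vec6 \<Rightarrow> mat6" where
  "dexp X = (\<Sum>i. (1 / fact (i + 1)) *\<^sub>R mpow (ad X) i)"

definition dexp_inv :: "vec6 \<Rightarrow> mat6" where
  "dexp_inv X = matrix_inv (dexp X)"

text \<open>
  The coefficients are analytic functions of \<open>\<phi>\<close> with a removable singularity at \<open>0\<close>; their value
  there is the limit of the formula valid for \<open>\<phi> \<noteq> 0\<close>. (\<open>sinc 0 = 1\<close> already holds.)
\<close>

definition lim_ext :: "(real \<Rightarrow> real) \<Rightarrow> real \<Rightarrow> real" where
  "lim_ext g t = (if t = 0 then Lim (at 0) g else g t)"

definition alpha :: "real \<Rightarrow> real" where
  "alpha \<phi> = sinc \<phi>"

definition beta :: "real \<Rightarrow> real" where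
  "beta \<phi> = (sinc (\<phi> / 2))\<^sup>2"

definition gamma :: "real \<Rightarrow> real" where
  "gamma \<phi> = alpha \<phi> / beta \<phi>"

definition delta :: "real \<Rightarrow> real" where
  "delta = lim_ext (\<lambda>\<phi>. (1 - alpha \<phi>) / \<phi>\<^sup>2)"

definition a1 :: "real \<Rightarrow> real" where
  "a1 \<phi> = beta \<phi> - alpha \<phi> / 2"

definition a2 :: "real \<Rightarrow> real" where
  "a2 \<phi> = 1 / 2 * (5 * delta \<phi> - beta \<phi> / 2)"

definition a3 :: "real \<Rightarrow> real" where
  "a3 = lim_ext (\<lambda>\<phi>. 1 / (2 * \<phi>\<^sup>2) * (beta \<phi> - alpha \<phi>))"

definition a4 :: "real \<Rightarrow> real" where
  "a4 = lim_ext (\<lambda>\<phi>. 1 / (2 * \<phi>\<^sup>2) * (3 * delta \<phi> - beta \<phi> / 2))"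

definition b1 :: "real \<Rightarrow> real" where
  "b1 \<phi> = - 1 / 2"

definition b2 :: "real \<Rightarrow> real" where
  "b2 = lim_ext (\<lambda>\<phi>. 1 / \<phi>\<^sup>2 * (2 - (1 + 3 * alpha \<phi>) / (2 * beta \<phi>)))"

definition b4 :: "real \<Rightarrow> real" where
  "b4 = lim_ext (\<lambda>\<phi>. 1 / \<phi> ^ 4 * (1 - (1 + alpha \<phi>) / (2 * beta \<phi>)))"

definition abar1 :: "real \<Rightarrow> real" where
  "abar1 = lim_ext (\<lambda>\<phi>. 1 / 4 * beta \<phi> + 1 / \<phi>\<^sup>2 * (5 / 2 * alpha \<phi> - 2 * beta \<phi> - 1 / 2))"

definition abar2 :: "real \<Rightarrow> real" where
  "abar2 = lim_ext (\<lambda>\<phi>. 1 / \<phi>\<^sup>2 * (7 / 4 * beta \<phi> - 1 / 2 * alpha \<phi>)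
     + 15 / (2 * \<phi> ^ 4) * (alpha \<phi> - 1))"

definition abar3 :: "real \<Rightarrow> real" where
  "abar3 = lim_ext (\<lambda>\<phi>. abar1 \<phi> / \<phi>\<^sup>2)"

definition abar4 :: "real \<Rightarrow> real" where
  "abar4 = lim_ext (\<lambda>\<phi>. abar2 \<phi> / \<phi>\<^sup>2)"

definition bbar1 :: "real \<Rightarrow> real" where
  "bbar1 \<phi> = 0"

definition bbar2 :: "real \<Rightarrow> real" where
  "bbar2 = lim_ext (\<lambda>\<phi>. 3 / (4 * \<phi>\<^sup>2) + 1 / \<phi> ^ 4 *
     (gamma \<phi> * (3 / 2 + 1 / beta \<phi> + 3 * gamma \<phi>) - 3 / (2 * beta \<phi>) - 4))"

definition bbar3 :: "real \<Rightarrow> real" where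
  "bbar3 \<phi> = 0"

definition bbar4 :: "real \<Rightarrow> real" where
  "bbar4 = lim_ext (\<lambda>\<phi>. 1 / (4 * \<phi> ^ 4) + 1 / \<phi> ^ 6 *
     (1 / (2 * beta \<phi>) + 3 / 2 * gamma \<phi> + gamma \<phi> / beta \<phi> + (gamma \<phi>)\<^sup>2 - 4))"

definition Zi :: "vec6 \<Rightarrow> vec6 \<Rightarrow> nat \<Rightarrow> vec6" where
  "Zi X Z i = mpow (ad X) i *v Z"

definition row_upper :: "vec6 \<Rightarrow> vec6" where
  "row_upper X = (\<chi> j. case j of Inl k \<Rightarrow> upper X $ k | Inr k \<Rightarrow> 0)"

definition col_row :: "vec6 \<Rightarrow> vec6 \<Rightarrow> mat6" where
  "col_row v w = (\<chi> i j. v $ i * w $ j)"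

text \<open>The library's \<open>jacobian\<close> is the matrix of directional derivatives.\<close>

lemma jacobian_directional:
  fixes f :: "real ^ 'n \<Rightarrow> real ^ 'm"
  assumes "f differentiable (at X)"
  shows "((\<lambda>t. f (X + t *\<^sub>R U)) has_vector_derivative jacobian f (at X) *v U) (at 0)"
proof -
  have "(f has_derivative (\<lambda>h. jacobian f (at X) *v h)) (at (X + 0 *\<^sub>R U))"
    using assms by (simp add: jacobian_works)
  moreover have "((\<lambda>t::real. X + t *\<^sub>R U) has_derivative (\<lambda>t. t *\<^sub>R U)) (at 0)"
    by (auto intro!: derivative_eq_intros)
  ultimately have "((\<lambda>t. f (X + t *\<^sub>R U)) has_derivative
      (\<lambda>t. jacobian f (at X) *v (t *\<^sub>R U))) (at 0)"
    using has_derivative_compose by blast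
  then show ?thesis
    by (simp add: has_vector_derivative_def matrix_vector_mult_scaleR)
qed

end

theory Submission
  imports Defs
begin

text \<open>
  Everything is a function of \<open>s = \<phi>\<^sup>2\<close>. In terms of the Stumpff functions
  \<open>c\<^sub>k(s) = \<Sum>n. (- s)^n / (2n + k)!\<close> one has \<open>\<alpha> = c\<^sub>1\<close>, \<open>\<beta> = 2 c\<^sub>2\<close> and \<open>\<delta> = c\<^sub>3\<close>, and
  the recurrence \<open>c\<^sub>k = 1 / k! - s c\<^bsub>k+2\<^esub>\<close> cancels the negative powers of \<open>\<phi>\<close> in the coefficients:
  \<open>a\<^sub>i\<close> and \<open>abar\<^sub>i\<close> are linear combinations of Stumpff functions, while \<open>b\<^sub>2\<close>, \<open>b\<^sub>4\<close> and
  \<open>bbar\<^sub>2\<close>, \<open>bbar\<^sub>4\<close> have only powers of \<open>c\<^sub>2\<close> in the denominator. So the singularities at \<open>\<phi> = 0\<close>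
  are removable, and the derivatives can be computed at \<open>x = 0\<close> as anywhere else. Since
  \<open>c\<^sub>k' = (k c\<^bsub>k+2\<^esub> - c\<^bsub>k+1\<^esub>) / 2\<close>, the barred coefficients turn out to be twice the derivatives with
  respect to \<open>s\<close> of the unbarred ones. The factor two is the one in the derivative
  \<open>2 (x \<bullet> u)\<close> of \<open>s\<close> in the direction \<open>U = (u, v)\<close>, which explains the terms with the row \<open>[x\<^sup>T 0]\<close>.

  The matrix \<open>N = ad X\<close> satisfies \<open>N^5 = - 2 s N^3 - s\<^sup>2 N\<close> (\<open>ad_annihilating_polynomial\<close>). Reducing
  the exponential series with it gives \<open>dexp X = I + a\<^sub>1 N + ... + a\<^sub>4 N^4\<close>
  (\<open>dexp_closed_form\<close>), and multiplying out shows that \<open>I - N / 2 + b\<^sub>2 N\<^sup>2 + b\<^sub>4 N^4\<close> is its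
  inverse (\<open>dexp_inv_closed_form\<close>); the identity needed there is \<open>sin\<^sup>2 + cos\<^sup>2 = 1\<close>,
  which reads \<open>c\<^sub>1\<^sup>2 = 2 c\<^sub>2 - s c\<^sub>2\<^sup>2\<close>.

  It remains to differentiate \<open>X \<mapsto> Z + \<Sum>i. p\<^sub>i(s) N^i Z\<close> (\<open>has_derivative_ad_polynomial\<close>). As
  \<open>ad\<close> is bilinear and antisymmetric, the derivative \<open>D\<^sub>i\<close> of \<open>N^i Z\<close> obeys
  \<open>D\<^bsub>i+1\<^esub> U = N (D\<^sub>i U) - ad (N^i Z) U\<close>, hence \<open>D\<^sub>i = - (\<Sum>j<i. N^j ad (N^(i-1-j) Z))\<close>. The
  Jacobi identity turns \<open>D\<^sub>2\<close> into \<open>ad Z N - 2 N ad Z\<close>. Both Jacobians are instances of this one formula,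
  which is continuous at \<open>X = 0\<close> with value \<open>- p\<^sub>1(0) ad Z\<close>; with \<open>a\<^sub>1(0) = 1/2\<close> and \<open>b\<^sub>1 = - 1/2\<close>
  these are the two limits.
\<close>

section \<open>Stumpff functions\<close>

definition stumpff :: "nat \<Rightarrow> real \<Rightarrow> real" where
  "stumpff k s = (\<Sum>n. (- 1) ^ n / fact (2 * n + k) * s ^ n)"

lemma summable_stumpff: "summable (\<lambda>n. (- 1) ^ n / fact (2 * n + k) * s ^ n :: real)"
proof (rule summable_comparison_test')
  show "summable (\<lambda>n. \<bar>s\<bar> ^ n / fact n)"
    using summable_exp_generic [of "\<bar>s\<bar>"] by (simp add: field_simps)
  show "norm ((- 1) ^ n / fact (2 * n + k) * s ^ n) \<le> \<bar>s\<bar> ^ n / fact n" for n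
    by (auto simp: abs_mult power_abs intro!: divide_left_mono fact_mono)
qed

lemma stumpff_sums: "(\<lambda>n. (- 1) ^ n / fact (2 * n + k) * s ^ n) sums stumpff k s"
  unfolding stumpff_def by (rule summable_sums [OF summable_stumpff])

lemma stumpff_rec: "stumpff k s = 1 / fact k - s * stumpff (k + 2) s"
proof -
  have "(\<lambda>n. - s * ((- 1) ^ n / fact (2 * n + (k + 2)) * s ^ n)) sums (- s * stumpff (k + 2) s)"
    by (rule sums_mult [OF stumpff_sums])
  then have "(\<lambda>n. (- 1) ^ Suc n / fact (2 * Suc n + k) * s ^ Suc n) sums (- s * stumpff (k + 2) s)"
    by (simp add: algebra_simps)
  from sums_Suc [OF this] have "stumpff k s = - s * stumpff (k + 2) s + 1 / fact k"
    by (intro sums_unique2 [OF stumpff_sums]) simp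
  then show ?thesis by simp
qed

lemma stumpff_at_0: "stumpff k 0 = 1 / fact k"
  using stumpff_rec [of k 0] by simp

lemma stumpff_recs:
  "stumpff 0 s = 1 - s * stumpff 2 s"
  "stumpff 1 s = 1 - s * stumpff 3 s"
  "stumpff 2 s = 1 / 2 - s * stumpff 4 s"
  "stumpff 3 s = 1 / 6 - s * stumpff 5 s"
  "stumpff 4 s = 1 / 24 - s * stumpff 6 s"
  "stumpff 5 s = 1 / 120 - s * stumpff 7 s"
proof -
  have *: "stumpff k s = 1 / fact k - s * stumpff m s" if "m = k + 2" for k m
    unfolding that by (rule stumpff_rec)
  show "stumpff 0 s = 1 - s * stumpff 2 s"
    using * [of 2 0] by simp
  show "stumpff 1 s = 1 - s * stumpff 3 s"
    using * [of 3 1] by simp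
  show "stumpff 2 s = 1 / 2 - s * stumpff 4 s"
    using * [of 4 2] by simp
  show "stumpff 3 s = 1 / 6 - s * stumpff 5 s"
    using * [of 5 3] by (simp add: fact_numeral)
  show "stumpff 4 s = 1 / 24 - s * stumpff 6 s"
    using * [of 6 4] by (simp add: fact_numeral)
  show "stumpff 5 s = 1 / 120 - s * stumpff 7 s"
    using * [of 7 5] by (simp add: fact_numeral)
qed

text \<open>
  Writing \<open>2 (n + 1) = (2n + 2 + k) - k\<close> splits each term into one term of \<open>c\<^bsub>k+1\<^esub>\<close> and one of
  \<open>c\<^bsub>k+2\<^esub>\<close>. The series is \<open>- c\<^sub>k'\<close>, and it is also the series that multiplies
  \<open>N^3\<close> and \<open>N^4\<close> in the exponential series of \<open>N = ad X\<close>.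
\<close>

lemma stumpff_shifted_weighted_sums:
  "(\<lambda>n. real (Suc n) * (- s) ^ n / fact (2 * Suc n + k))
     sums ((stumpff (k + 1) s - real k * stumpff (k + 2) s) / 2)"
proof -
  have "real (Suc n) * (- s) ^ n / fact (2 * Suc n + k)
      = ((- 1) ^ n / fact (2 * n + (k + 1)) * s ^ n - real k * ((- 1) ^ n / fact (2 * n + (k + 2)) * s ^ n)) / 2" for n
  proof -
    define F where "F = (fact (2 * n + (k + 1)) :: real)"
    define m where "m = real (2 * n + k + 2)"
    have f: "fact (2 * n + (k + 2)) = m * F"
      using fact_Suc [of "2 * n + k + 1", where 'a = real] by (simp add: F_def m_def)
    have nz: "F \<noteq> 0" "m \<noteq> 0" by (simp_all add: F_def m_def)
    have m: "2 * real (Suc n) = m - real k" by (simp add: m_def)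
    have "2 * Suc n + k = 2 * n + (k + 2)" by simp
    then have "real (Suc n) * (- s) ^ n / fact (2 * Suc n + k) = (2 * real (Suc n)) * (- s) ^ n / (2 * (m * F))"
      by (simp only: f mult.assoc mult_divide_mult_cancel_left_if) simp
    also have "\<dots> = ((- 1) ^ n / F * s ^ n - real k * ((- 1) ^ n / (m * F) * s ^ n)) / 2"
      unfolding m power_minus [of s] using nz by (simp add: divide_simps) (simp add: algebra_simps)
    finally show ?thesis unfolding f F_def .
  qed
  then show ?thesis
    by (simp only:) (intro sums_divide sums_diff sums_mult stumpff_sums)
qed

lemma stumpff_weighted_sums:
  "(\<lambda>n. real n * (- s) ^ (n - 1) / fact (2 * n + k)) sums ((stumpff (k + 1) s - real k * stumpff (k + 2) s) / 2)"
proof -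
  have "(\<lambda>n. real (Suc n) * (- s) ^ (Suc n - 1) / fact (2 * Suc n + k))
      sums ((stumpff (k + 1) s - real k * stumpff (k + 2) s) / 2)"
    using stumpff_shifted_weighted_sums [of s k] by (simp only: diff_Suc_1)
  from sums_Suc [OF this] show ?thesis by simp
qed

text \<open>
  The companion series, which multiplies \<open>N\<close> and \<open>N\<^sup>2\<close> in the exponential series of \<open>N = ad X\<close>.
\<close>

lemma stumpff_complementary_sums:
  "(\<lambda>n. (1 - real n) * (- s) ^ n / fact (2 * n + k))
    sums (stumpff k s + s * ((stumpff (k + 1) s - real k * stumpff (k + 2) s) / 2))"
proof -
  have "(1 - real n) * (- s) ^ n / fact (2 * n + k) =
      (- 1) ^ n / fact (2 * n + k) * s ^ n + s * (real n * (- s) ^ (n - 1) / fact (2 * n + k))" for n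
    unfolding power_minus [of s] by (cases n) (simp_all add: field_simps del: fact_Suc)
  then show ?thesis
    using sums_add [OF stumpff_sums sums_mult [OF stumpff_weighted_sums]] by (simp only:)
qed

lemma stumpff_deriv:
  "(stumpff k has_real_derivative (real k * stumpff (k + 2) s - stumpff (k + 1) s) / 2) (at s)"
proof -
  define c where "c = (\<lambda>n. (- 1) ^ n / fact (2 * n + k) :: real)"
  have der: "(stumpff k has_real_derivative (\<Sum>n. diffs c n * s ^ n)) (at s)"
    unfolding stumpff_def c_def
    by (rule termdiffs_strong_converges_everywhere [OF summable_stumpff])
  have coeff: "diffs c n * s ^ n = - (real (Suc n) * (- s) ^ n / fact (2 * Suc n + k))" for n
    unfolding power_minus [of s] by (simp add: diffs_def c_def del: fact_Suc of_nat_Suc mult_Suc_right)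
  have "(\<lambda>n. diffs c n * s ^ n) sums (- ((stumpff (k + 1) s - real k * stumpff (k + 2) s) / 2))"
    unfolding coeff by (intro sums_minus stumpff_shifted_weighted_sums)
  then have "(\<lambda>n. diffs c n * s ^ n) sums ((real k * stumpff (k + 2) s - stumpff (k + 1) s) / 2)"
    by (simp only: minus_divide_left minus_diff_eq)
  then show ?thesis using der by (simp only: sums_iff)
qed

lemma continuous_stumpff: "isCont (stumpff k) s"
  using stumpff_deriv DERIV_isCont by blast

lemma stumpff_derivs:
  "(stumpff 1 has_real_derivative (stumpff 3 s - stumpff 2 s) / 2) (at s)"
  "(stumpff 2 has_real_derivative (2 * stumpff 4 s - stumpff 3 s) / 2) (at s)"
  "(stumpff 3 has_real_derivative (3 * stumpff 5 s - stumpff 4 s) / 2) (at s)"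
  "(stumpff 4 has_real_derivative (4 * stumpff 6 s - stumpff 5 s) / 2) (at s)"
  "(stumpff 5 has_real_derivative (5 * stumpff 7 s - stumpff 6 s) / 2) (at s)"
proof -
  have *: "(stumpff k has_real_derivative (real k * stumpff m s - stumpff l s) / 2) (at s)"
    if "l = k + 1" "m = k + 2" for k l m
    unfolding that by (rule stumpff_deriv)
  show "(stumpff 1 has_real_derivative (stumpff 3 s - stumpff 2 s) / 2) (at s)"
    using * [of 2 1 3] by simp
  show "(stumpff 2 has_real_derivative (2 * stumpff 4 s - stumpff 3 s) / 2) (at s)"
    using * [of 3 2 4] by simp
  show "(stumpff 3 has_real_derivative (3 * stumpff 5 s - stumpff 4 s) / 2) (at s)"
    using * [of 4 3 5] by simp
  show "(stumpff 4 has_real_derivative (4 * stumpff 6 s - stumpff 5 s) / 2) (at s)"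
    using * [of 5 4 6] by simp
  show "(stumpff 5 has_real_derivative (5 * stumpff 7 s - stumpff 6 s) / 2) (at s)"
    using * [of 6 5 7] by simp
qed

lemmas stumpff_deriv_chain [derivative_intros] = stumpff_derivs [THEN DERIV_chain2]

lemma stumpff_mults:
  "s * stumpff 3 s = 1 - stumpff 1 s"
  "s * stumpff 4 s = 1 / 2 - stumpff 2 s"
  "s * stumpff 5 s = 1 / 6 - stumpff 3 s"
  "s * stumpff 6 s = 1 / 24 - stumpff 4 s"
  using stumpff_recs(2-5) [of s] by (auto simp only: diff_diff_eq2)

lemma stumpff_quotients:
  assumes "s \<noteq> 0"
  shows "stumpff 3 s = (1 - stumpff 1 s) / s" "stumpff 4 s = (1 / 2 - stumpff 2 s) / s"
    "stumpff 5 s = (1 / 6 - stumpff 3 s) / s" "stumpff 6 s = (1 / 24 - stumpff 4 s) / s"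
  using assms by (simp_all only: stumpff_mults [symmetric] nonzero_mult_div_cancel_left not_False_eq_True)

lemma stumpff_0_square: "stumpff 0 (t\<^sup>2) = cos t"
  by (rule sums_unique2 [OF stumpff_sums]) (use cos_paired [of t] in \<open>simp add: power_mult\<close>)

lemma stumpff_1_square: "stumpff 1 (t\<^sup>2) = alpha t"
proof (cases "t = 0")
  case True
  then show ?thesis by (simp add: alpha_def stumpff_at_0)
next
  case False
  have "(\<lambda>n. t * ((- 1) ^ n / fact (2 * n + 1) * (t\<^sup>2) ^ n)) sums (t * stumpff 1 (t\<^sup>2))"
    by (rule sums_mult [OF stumpff_sums])
  moreover have "t * ((- 1) ^ n / fact (2 * n + 1) * (t\<^sup>2) ^ n)
      = (- 1) ^ n / fact (2 * n + 1) * t ^ (2 * n + 1)" for n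
    unfolding power_add power_mult by simp
  ultimately have "(\<lambda>n. (- 1) ^ n / fact (2 * n + 1) * t ^ (2 * n + 1)) sums (t * stumpff 1 (t\<^sup>2))"
    by (simp only:)
  then have "sin t = t * stumpff 1 (t\<^sup>2)"
    using sin_paired sums_unique2 by blast
  with False show ?thesis by (simp add: alpha_def)
qed

lemma stumpff_2_square: "2 * stumpff 2 (t\<^sup>2) = beta t"
proof (cases "t = 0")
  case True
  then show ?thesis by (simp add: beta_def stumpff_at_0)
next
  case False
  have "cos t = 1 - t\<^sup>2 * stumpff 2 (t\<^sup>2)"
    using stumpff_recs(1) [of "t\<^sup>2"] by (simp add: stumpff_0_square)
  moreover have "cos t = 1 - 2 * (sin (t / 2))\<^sup>2"
    using cos_double_sin [of "t / 2"] by simp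
  ultimately have "t\<^sup>2 * stumpff 2 (t\<^sup>2) = 2 * (sin (t / 2))\<^sup>2" by simp
  then have "stumpff 2 (t\<^sup>2) = 2 * (sin (t / 2))\<^sup>2 / t\<^sup>2"
    using False by (simp add: eq_divide_eq mult.commute)
  moreover have "beta t = 4 * (sin (t / 2))\<^sup>2 / t\<^sup>2"
    using False by (simp add: beta_def power_divide power_mult_distrib)
  ultimately show ?thesis by simp
qed

text \<open>
  This is \<open>sin\<^sup>2 + cos\<^sup>2 = 1\<close> with the common factor \<open>s\<close> removed.
\<close>

lemma stumpff_pythagoras:
  assumes "s \<ge> 0"
  shows "(stumpff 1 s)\<^sup>2 = 2 * stumpff 2 s - s * (stumpff 2 s)\<^sup>2"
proof (cases "s = 0")
  case True
  then show ?thesis by (simp add: stumpff_at_0)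
next
  case False
  define t where "t = sqrt s"
  have s: "s = t\<^sup>2" and "t \<noteq> 0" using assms False by (auto simp: t_def)
  have "cos t = 1 - s * stumpff 2 s"
    using stumpff_recs(1) [of "t\<^sup>2"] by (simp add: stumpff_0_square s)
  moreover have "sin t = t * stumpff 1 s"
    unfolding s stumpff_1_square alpha_def using \<open>t \<noteq> 0\<close> by simp
  ultimately have "(t * stumpff 1 s)\<^sup>2 + (1 - s * stumpff 2 s)\<^sup>2 = 1"
    using sin_cos_squared_add [of t] by simp
  then have "s * (stumpff 1 s)\<^sup>2 = s * (2 * stumpff 2 s - s * (stumpff 2 s)\<^sup>2)"
    unfolding power_mult_distrib s [symmetric] by (simp add: power2_eq_square algebra_simps)
  with False show ?thesis by simp
qed

text \<open>
  The Pythagorean identity is \<open>s\<close> times this one. The reduced form is what makes the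
  numerator of \<open>b\<^sub>4\<close> divisible by \<open>s\<^sup>2\<close>.
\<close>

lemma stumpff_pythagoras_reduced:
  assumes "s \<ge> 0"
  shows "2 * stumpff 4 s + s * (stumpff 3 s)\<^sup>2 + (stumpff 2 s)\<^sup>2 = 2 * stumpff 3 s"
proof (cases "s = 0")
  case True
  then show ?thesis by (simp add: stumpff_at_0 fact_numeral power2_eq_square)
next
  case False
  have "s * (2 * stumpff 4 s + s * (stumpff 3 s)\<^sup>2 + (stumpff 2 s)\<^sup>2) = s * (2 * stumpff 3 s)"
  proof -
    have c: "s * stumpff 3 s = 1 - stumpff 1 s" "s * stumpff 4 s = 1 / 2 - stumpff 2 s"
      using stumpff_recs(2,3) [of s] by simp_all
    have "s * (2 * stumpff 4 s + s * (stumpff 3 s)\<^sup>2 + (stumpff 2 s)\<^sup>2)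
        = 2 * (s * stumpff 4 s) + (s * stumpff 3 s)\<^sup>2 + s * (stumpff 2 s)\<^sup>2"
      by (simp add: algebra_simps power2_eq_square)
    also have "\<dots> = 2 * (s * stumpff 3 s)"
      unfolding c using stumpff_pythagoras [OF assms] by (simp add: algebra_simps power2_eq_square)
    finally show ?thesis by simp
  qed
  with False show ?thesis by simp
qed

section \<open>The coefficients of dexp as functions of the squared norm\<close>

text \<open>
  The bridge from the defining formulas, singular at \<open>0\<close>, to regular functions of \<open>t\<^sup>2\<close>. The equation
  between \<open>g\<close> and \<open>h\<close> is asked for only near \<open>0\<close> and at \<open>t\<close>, because the formulas for the inverse
  agree with the regular functions only where \<open>\<beta> \<noteq> 0\<close>.
\<close>

lemma lim_ext_square:
  assumes "isCont h 0" and "\<forall>\<^sub>F t in at 0. g t = h (t\<^sup>2)" and "t \<noteq> 0 \<Longrightarrow> g t = h (t\<^sup>2)"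
  shows "lim_ext g t = h (t\<^sup>2)"
proof (cases "t = 0")
  case True
  have "((\<lambda>t::real. t\<^sup>2) \<longlongrightarrow> 0) (at 0)"
    by (auto intro!: tendsto_eq_intros)
  then have "((\<lambda>t. h (t\<^sup>2)) \<longlongrightarrow> h 0) (at 0)"
    by (rule isCont_tendsto_compose [OF assms(1)])
  then have "(g \<longlongrightarrow> h 0) (at 0)"
    by (rule Lim_transform_eventually) (use assms(2) in \<open>simp add: eq_commute\<close>)
  then have "Lim (at 0) g = h 0" by (intro tendsto_Lim) auto
  with True show ?thesis by (simp add: lim_ext_def)
qed (simp add: lim_ext_def assms)

lemma lim_ext_square_all:
  assumes "isCont h 0" and "\<And>t. t \<noteq> 0 \<Longrightarrow> g t = h (t\<^sup>2)"
  shows "lim_ext g t = h (t\<^sup>2)"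
  by (rule lim_ext_square [OF assms(1)])
     (use assms(2) in \<open>auto simp: eventually_at_filter\<close>)

lemma delta_eq: "delta t = stumpff 3 (t\<^sup>2)"
  unfolding delta_def
proof (rule lim_ext_square_all [OF continuous_stumpff])
  fix t :: real assume "t \<noteq> 0"
  then show "(1 - alpha t) / t\<^sup>2 = stumpff 3 (t\<^sup>2)"
    unfolding stumpff_1_square [symmetric] stumpff_recs(2) [of "t\<^sup>2"] by simp
qed

lemma a1_eq: "a1 t = 2 * stumpff 2 (t\<^sup>2) - stumpff 1 (t\<^sup>2) / 2"
  by (simp only: a1_def stumpff_1_square stumpff_2_square)

lemma a2_eq: "a2 t = (5 * stumpff 3 (t\<^sup>2) - stumpff 2 (t\<^sup>2)) / 2"
  by (simp add: a2_def delta_eq flip: stumpff_2_square)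

lemma a3_eq: "a3 t = (stumpff 3 (t\<^sup>2) - 2 * stumpff 4 (t\<^sup>2)) / 2"
  unfolding a3_def
proof (rule lim_ext_square_all)
  fix t :: real assume "t \<noteq> 0"
  then show "1 / (2 * t\<^sup>2) * (beta t - alpha t) = (stumpff 3 (t\<^sup>2) - 2 * stumpff 4 (t\<^sup>2)) / 2"
    unfolding stumpff_1_square [symmetric] stumpff_2_square [symmetric] stumpff_recs(2,3) [of "t\<^sup>2"]
    by (simp add: field_simps)
qed (intro continuous_intros continuous_stumpff, auto)

lemma a4_eq: "a4 t = (stumpff 4 (t\<^sup>2) - 3 * stumpff 5 (t\<^sup>2)) / 2"
  unfolding a4_def
proof (rule lim_ext_square_all)
  fix t :: real assume "t \<noteq> 0"
  then show "1 / (2 * t\<^sup>2) * (3 * delta t - beta t / 2) = (stumpff 4 (t\<^sup>2) - 3 * stumpff 5 (t\<^sup>2)) / 2"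
    unfolding delta_eq stumpff_2_square [symmetric] stumpff_recs(3,4) [of "t\<^sup>2"]
    by (simp add: field_simps)
qed (intro continuous_intros continuous_stumpff, auto)

lemma abar1_eq: "abar1 t = (8 * stumpff 4 (t\<^sup>2) - 5 * stumpff 3 (t\<^sup>2) + stumpff 2 (t\<^sup>2)) / 2"
  unfolding abar1_def
proof (rule lim_ext_square_all)
  fix t :: real assume "t \<noteq> 0"
  then show "1 / 4 * beta t + 1 / t\<^sup>2 * (5 / 2 * alpha t - 2 * beta t - 1 / 2)
      = (8 * stumpff 4 (t\<^sup>2) - 5 * stumpff 3 (t\<^sup>2) + stumpff 2 (t\<^sup>2)) / 2"
    unfolding stumpff_1_square [symmetric] stumpff_2_square [symmetric] stumpff_recs(2,3) [of "t\<^sup>2"]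
    by (simp add: field_simps)
qed (intro continuous_intros continuous_stumpff, auto)

lemma abar2_eq: "abar2 t = (15 * stumpff 5 (t\<^sup>2) - 7 * stumpff 4 (t\<^sup>2) + stumpff 3 (t\<^sup>2)) / 2"
  unfolding abar2_def
proof (rule lim_ext_square_all)
  fix t :: real assume "t \<noteq> 0"
  define s where "s = t\<^sup>2"
  have "s \<noteq> 0" "t ^ 4 = s\<^sup>2" using \<open>t \<noteq> 0\<close> by (simp_all add: s_def)
  then show "1 / t\<^sup>2 * (7 / 4 * beta t - 1 / 2 * alpha t) + 15 / (2 * t ^ 4) * (alpha t - 1)
      = (15 * stumpff 5 (t\<^sup>2) - 7 * stumpff 4 (t\<^sup>2) + stumpff 3 (t\<^sup>2)) / 2"
    unfolding stumpff_1_square [symmetric] stumpff_2_square [symmetric] s_def [symmetric]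
      stumpff_recs(2,3,4) [of s]
    by (simp add: field_simps power2_eq_square)
qed (intro continuous_intros continuous_stumpff, auto)

lemma abar3_eq: "abar3 t = (5 * stumpff 5 (t\<^sup>2) - stumpff 4 (t\<^sup>2) - 8 * stumpff 6 (t\<^sup>2)) / 2"
  unfolding abar3_def
proof (rule lim_ext_square_all)
  fix t :: real assume "t \<noteq> 0"
  then show "abar1 t / t\<^sup>2 = (5 * stumpff 5 (t\<^sup>2) - stumpff 4 (t\<^sup>2) - 8 * stumpff 6 (t\<^sup>2)) / 2"
    unfolding abar1_eq stumpff_recs(3,4,5) [of "t\<^sup>2"]
    by (simp add: field_simps)
qed (intro continuous_intros continuous_stumpff, auto)

lemma abar4_eq: "abar4 t = (7 * stumpff 6 (t\<^sup>2) - stumpff 5 (t\<^sup>2) - 15 * stumpff 7 (t\<^sup>2)) / 2"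
  unfolding abar4_def
proof (rule lim_ext_square_all)
  fix t :: real assume "t \<noteq> 0"
  then show "abar2 t / t\<^sup>2 = (7 * stumpff 6 (t\<^sup>2) - stumpff 5 (t\<^sup>2) - 15 * stumpff 7 (t\<^sup>2)) / 2"
    unfolding abar2_eq stumpff_recs(4,5,6) [of "t\<^sup>2"]
    by (simp add: field_simps)
qed (intro continuous_intros continuous_stumpff, auto)

section \<open>The coefficients of the inverse\<close>

lemma eventually_beta_nonzero: "\<forall>\<^sub>F t in at 0. beta t \<noteq> 0 \<and> t \<noteq> 0"
proof -
  have "isCont (\<lambda>t::real. stumpff 2 (t\<^sup>2)) 0"
    by (rule isCont_o2 [OF _ continuous_stumpff]) simp
  then have "isCont (\<lambda>t::real. 2 * stumpff 2 (t\<^sup>2)) 0"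
    by simp
  moreover have "beta 0 = 1" by (simp add: beta_def)
  ultimately have "((\<lambda>t. beta t) \<longlongrightarrow> 1) (at 0)"
    by (simp add: isCont_def stumpff_2_square)
  then have "\<forall>\<^sub>F t in at 0. beta t \<noteq> 0" by (rule tendsto_imp_eventually_ne) simp
  moreover have "\<forall>\<^sub>F t in at 0. t \<noteq> (0::real)" by (simp add: eventually_at_filter)
  ultimately show ?thesis by eventually_elim simp
qed

lemma lim_ext_square_beta:
  assumes "isCont h 0" and "beta t \<noteq> 0"
    and "\<And>t. beta t \<noteq> 0 \<Longrightarrow> t \<noteq> 0 \<Longrightarrow> g t = h (t\<^sup>2)"
  shows "lim_ext g t = h (t\<^sup>2)"
proof (rule lim_ext_square [OF assms(1)])
  show "\<forall>\<^sub>F t in at 0. g t = h (t\<^sup>2)"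
    by (rule eventually_mono [OF eventually_beta_nonzero]) (blast intro: assms(3))
  show "g t = h (t\<^sup>2)" if "t \<noteq> 0"
    using assms(2) that by (rule assms(3))
qed

text \<open>
  \<open>B2\<close> and \<open>B4\<close> are \<open>b\<^sub>2\<close> and \<open>b\<^sub>4\<close> as functions of \<open>s = \<phi>\<^sup>2\<close>, with the powers of \<open>s\<close> in the
  denominator cancelled: for \<open>s > 0\<close> the two numerators are \<open>(8 c\<^sub>2 - 1 - 3 c\<^sub>1) / s\<close> and
  \<open>(4 c\<^sub>2 - 1 - c\<^sub>1) / s\<^sup>2\<close>.
\<close>

definition B2 :: "real \<Rightarrow> real" where
  "B2 s = (3 * stumpff 3 s - 8 * stumpff 4 s) / (4 * stumpff 2 s)"

definition B4 :: "real \<Rightarrow> real" where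
  "B4 s = (3 * stumpff 5 s - stumpff 4 s + 2 * (stumpff 3 s)\<^sup>2 - 2 * stumpff 2 s * stumpff 4 s)
     / (4 * stumpff 2 s)"

text \<open>
  The derivatives of \<open>B2\<close> and \<open>B4\<close> by the quotient rule. The explicit form shows that they are
  continuous at \<open>0\<close>, which gives the finite limits of \<open>bbar\<^sub>2\<close> and \<open>bbar\<^sub>4\<close>.
\<close>

definition dB2 :: "real \<Rightarrow> real" where
  "dB2 s = (17 * stumpff 5 s - 3 * stumpff 4 s - 32 * stumpff 6 s) / (8 * stumpff 2 s)
     - (3 * stumpff 3 s - 8 * stumpff 4 s) * (2 * stumpff 4 s - stumpff 3 s) / (8 * (stumpff 2 s)\<^sup>2)"

definition dB4 :: "real \<Rightarrow> real" where
  "dB4 s = (15 * stumpff 7 s - 7 * stumpff 6 s + stumpff 5 s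
       + 4 * stumpff 3 s * (3 * stumpff 5 s - stumpff 4 s)
       - 2 * (2 * stumpff 4 s - stumpff 3 s) * stumpff 4 s
       - 2 * stumpff 2 s * (4 * stumpff 6 s - stumpff 5 s)) / (8 * stumpff 2 s)
     - (3 * stumpff 5 s - stumpff 4 s + 2 * (stumpff 3 s)\<^sup>2 - 2 * stumpff 2 s * stumpff 4 s)
       * (2 * stumpff 4 s - stumpff 3 s) / (8 * (stumpff 2 s)\<^sup>2)"

lemma DERIV_divide_quarter:
  assumes "(f has_real_derivative A / 2) (at s)" "(g has_real_derivative E / 2) (at s)" "g s \<noteq> 0"
  shows "((\<lambda>s. f s / (4 * g s)) has_real_derivative A / (8 * g s) - f s * E / (8 * (g s)\<^sup>2)) (at s)"
proof -
  have "((\<lambda>s. f s / (4 * g s)) has_real_derivative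
      (A / 2 * (4 * g s) - f s * (4 * (E / 2))) / (4 * g s * (4 * g s))) (at s)"
    using assms by (intro DERIV_divide DERIV_cmult) auto
  also have "(A / 2 * (4 * g s) - f s * (4 * (E / 2))) / (4 * g s * (4 * g s))
      = A / (8 * g s) - f s * E / (8 * (g s)\<^sup>2)"
    using assms(3) by (simp add: field_simps power2_eq_square)
  finally show ?thesis .
qed

lemma B2_deriv:
  assumes "stumpff 2 s \<noteq> 0"
  shows "(B2 has_real_derivative dB2 s) (at s)"
proof -
  have "((\<lambda>s. 3 * stumpff 3 s - 8 * stumpff 4 s) has_real_derivative
      (17 * stumpff 5 s - 3 * stumpff 4 s - 32 * stumpff 6 s) / 2) (at s)"
    by (rule derivative_eq_intros refl)+ (simp add: field_simps)
  from DERIV_divide_quarter [OF this stumpff_derivs(2) assms] show ?thesis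
    unfolding B2_def [abs_def] dB2_def .
qed

lemma B4_deriv:
  assumes "stumpff 2 s \<noteq> 0"
  shows "(B4 has_real_derivative dB4 s) (at s)"
proof -
  have "((\<lambda>s. 3 * stumpff 5 s - stumpff 4 s + 2 * (stumpff 3 s)\<^sup>2 - 2 * stumpff 2 s * stumpff 4 s)
      has_real_derivative
      (15 * stumpff 7 s - 7 * stumpff 6 s + stumpff 5 s
       + 4 * stumpff 3 s * (3 * stumpff 5 s - stumpff 4 s)
       - 2 * (2 * stumpff 4 s - stumpff 3 s) * stumpff 4 s
       - 2 * stumpff 2 s * (4 * stumpff 6 s - stumpff 5 s)) / 2) (at s)"
    by (rule derivative_eq_intros refl)+ (simp add: field_simps)
  from DERIV_divide_quarter [OF this stumpff_derivs(2) assms] show ?thesis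
    unfolding B4_def [abs_def] dB4_def .
qed

lemma b2_eq:
  assumes "beta t \<noteq> 0"
  shows "b2 t = B2 (t\<^sup>2)"
  unfolding b2_def
proof (rule lim_ext_square_beta [OF _ assms])
  fix t :: real assume "t \<noteq> 0" and b: "beta t \<noteq> 0"
  have "stumpff 2 (t\<^sup>2) \<noteq> 0" using b stumpff_2_square [of t] by auto
  moreover have "8 * stumpff 2 (t\<^sup>2) - 1 - 3 * stumpff 1 (t\<^sup>2) = t\<^sup>2 * (3 * stumpff 3 (t\<^sup>2) - 8 * stumpff 4 (t\<^sup>2))"
    using stumpff_recs(2,3) [of "t\<^sup>2"] by (simp add: algebra_simps del: One_nat_def)
  ultimately show "1 / t\<^sup>2 * (2 - (1 + 3 * alpha t) / (2 * beta t)) = B2 (t\<^sup>2)"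
    unfolding stumpff_1_square [symmetric] stumpff_2_square [symmetric] B2_def
    using \<open>t \<noteq> 0\<close> by (simp add: divide_simps del: One_nat_def) (simp add: algebra_simps del: One_nat_def)
qed (rule DERIV_isCont [OF B2_deriv], simp add: stumpff_at_0)

text \<open>
  Multiplying the numerator of \<open>B4\<close> by \<open>s\<close> twice, the recurrence lowers all indices to \<open>1\<close> and \<open>2\<close>;
  the square of \<open>c\<^sub>3\<close> is eliminated by the reduced Pythagorean identity.
\<close>

lemma B4_closed_form:
  assumes "s > 0" and nz: "stumpff 2 s \<noteq> 0"
  shows "B4 s = 1 / s\<^sup>2 * (1 - (1 + stumpff 1 s) / (4 * stumpff 2 s))"
proof -
  define N where "N = 3 * stumpff 5 s - stumpff 4 s + 2 * (stumpff 3 s)\<^sup>2 - 2 * stumpff 2 s * stumpff 4 s"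
  have r: "s * stumpff 3 s = 1 - stumpff 1 s" "s * stumpff 4 s = 1 / 2 - stumpff 2 s"
    "s * stumpff 5 s = 1 / 6 - stumpff 3 s"
    by (rule stumpff_mults)+
  have q: "2 * (s * (stumpff 3 s)\<^sup>2) = 4 * stumpff 3 s - 4 * stumpff 4 s - 2 * (stumpff 2 s)\<^sup>2"
    using stumpff_pythagoras_reduced [of s] \<open>s > 0\<close> by simp
  have "s * N = 3 * (s * stumpff 5 s) - s * stumpff 4 s + 2 * (s * (stumpff 3 s)\<^sup>2)
       - 2 * stumpff 2 s * (s * stumpff 4 s)"
    by (simp add: N_def algebra_simps)
  also have "\<dots> = stumpff 3 s - 4 * stumpff 4 s"
    unfolding r q by (simp add: algebra_simps power2_eq_square)
  finally have "s\<^sup>2 * N = s * stumpff 3 s - 4 * (s * stumpff 4 s)"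
    by (simp only: power2_eq_square mult.assoc right_diff_distrib mult.left_commute)
  then have *: "s\<^sup>2 * N = 4 * stumpff 2 s - 1 - stumpff 1 s"
    unfolding r by simp
  have "B4 s = (s\<^sup>2 * N) / (s\<^sup>2 * (4 * stumpff 2 s))"
    using \<open>s > 0\<close> by (simp add: B4_def N_def)
  also have "\<dots> = 1 / s\<^sup>2 * (1 - (1 + stumpff 1 s) / (4 * stumpff 2 s))"
    unfolding * using nz \<open>s > 0\<close> by (simp add: divide_simps)
  finally show ?thesis .
qed

lemma b4_eq:
  assumes "beta t \<noteq> 0"
  shows "b4 t = B4 (t\<^sup>2)"
  unfolding b4_def
proof (rule lim_ext_square_beta [OF _ assms])
  fix t :: real assume "t \<noteq> 0" and b: "beta t \<noteq> 0"
  have "stumpff 2 (t\<^sup>2) \<noteq> 0" using b stumpff_2_square [of t] by auto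
  then show "1 / t ^ 4 * (1 - (1 + alpha t) / (2 * beta t)) = B4 (t\<^sup>2)"
    using B4_closed_form [of "t\<^sup>2"] \<open>t \<noteq> 0\<close>
    unfolding stumpff_1_square [symmetric] stumpff_2_square [symmetric] by simp
qed (rule DERIV_isCont [OF B4_deriv], simp add: stumpff_at_0)

text \<open>
  Lowering all indices to \<open>1\<close> and \<open>2\<close> by the recurrence makes both sides the same rational function of
  \<open>s\<close>, \<open>c\<^sub>1\<close> and \<open>c\<^sub>2\<close>.
\<close>

lemma bbar2_closed_form:
  assumes "s \<noteq> 0" and nz: "stumpff 2 s \<noteq> 0"
  shows "2 * dB2 s = 3 / (4 * s) + 1 / s\<^sup>2 *
    (stumpff 1 s / (2 * stumpff 2 s) * (3 / 2 + 1 / (2 * stumpff 2 s)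
      + 3 * (stumpff 1 s / (2 * stumpff 2 s))) - 3 / (4 * stumpff 2 s) - 4)"
proof -
  define u where "u = stumpff 1 s"
  define v where "v = stumpff 2 s"
  have c: "stumpff 3 s = (1 - u) / s" "stumpff 4 s = (1 / 2 - v) / s"
    "stumpff 5 s = (1 / 6 - (1 - u) / s) / s" "stumpff 6 s = (1 / 24 - (1 / 2 - v) / s) / s"
    unfolding u_def v_def
    using stumpff_quotients [OF \<open>s \<noteq> 0\<close>] by (simp_all only:)
  show ?thesis
    using nz \<open>s \<noteq> 0\<close> unfolding dB2_def u_def [symmetric] v_def [symmetric] c
    by (simp add: divide_simps) (simp add: algebra_simps power2_eq_square)
qed

lemma bbar2_eq:
  assumes "beta t \<noteq> 0"
  shows "bbar2 t = 2 * dB2 (t\<^sup>2)"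
  unfolding bbar2_def
proof (rule lim_ext_square_beta [OF _ assms])
  fix t :: real assume "t \<noteq> 0" and b: "beta t \<noteq> 0"
  have "stumpff 2 (t\<^sup>2) \<noteq> 0" using b stumpff_2_square [of t] by auto
  then show "3 / (4 * t\<^sup>2) + 1 / t ^ 4 *
     (gamma t * (3 / 2 + 1 / beta t + 3 * gamma t) - 3 / (2 * beta t) - 4) = 2 * dB2 (t\<^sup>2)"
    using bbar2_closed_form [of "t\<^sup>2"] \<open>t \<noteq> 0\<close>
    unfolding gamma_def stumpff_1_square [symmetric] stumpff_2_square [symmetric] by simp
next
  show "isCont (\<lambda>s. 2 * dB2 s) 0"
    unfolding dB2_def
    by (intro continuous_intros continuous_stumpff) (simp_all add: stumpff_at_0)
qed

text \<open>
  For \<open>s > 0\<close> the function \<open>B4\<close> agrees locally with its closed form in \<open>c\<^sub>1\<close> and \<open>c\<^sub>2\<close>. Differentiating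
  that form and comparing with \<open>dB4\<close> avoids simplifying \<open>dB4\<close> by means of the Pythagorean identity.
\<close>

lemma bbar4_closed_form:
  assumes "s > 0" and nz: "stumpff 2 s \<noteq> 0"
  shows "2 * dB4 s = 1 / (4 * s\<^sup>2) + 1 / s ^ 3 *
     (1 / (4 * stumpff 2 s) + 3 / 2 * (stumpff 1 s / (2 * stumpff 2 s))
      + stumpff 1 s / (2 * stumpff 2 s) / (2 * stumpff 2 s) + (stumpff 1 s / (2 * stumpff 2 s))\<^sup>2 - 4)"
proof -
  define u where "u = stumpff 1 s"
  define v where "v = stumpff 2 s"
  let ?D = "- 2 / s ^ 3 * (1 - (1 + u) / (4 * v))
       + 1 / s\<^sup>2 * ((1 + u) * (2 * stumpff 4 s - stumpff 3 s) / (8 * v\<^sup>2) - (stumpff 3 s - v) / (8 * v))"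
  have Q: "((\<lambda>s. (1 + stumpff 1 s) / (4 * stumpff 2 s)) has_real_derivative
      (stumpff 3 s - v) / (8 * v) - (1 + u) * (2 * stumpff 4 s - stumpff 3 s) / (8 * v\<^sup>2)) (at s)"
    unfolding u_def v_def
    by (rule DERIV_divide_quarter [OF _ stumpff_derivs(2) nz])
       (rule DERIV_cong [OF DERIV_add [OF DERIV_const stumpff_derivs(1)]], simp)
  have P: "((\<lambda>s. 1 / s\<^sup>2) has_real_derivative - 2 / s ^ 3) (at s)"
    using \<open>s > 0\<close>
    by (auto intro!: derivative_eq_intros simp: divide_simps power2_eq_square power3_eq_cube)
  have "((\<lambda>s. 1 / s\<^sup>2 * (1 - (1 + stumpff 1 s) / (4 * stumpff 2 s))) has_real_derivative ?D) (at s)"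
    by (rule DERIV_cong [OF DERIV_mult [OF P DERIV_diff [OF DERIV_const Q]]])
       (simp add: u_def v_def)
  moreover have "\<forall>\<^sub>F x in nhds s. B4 x = 1 / x\<^sup>2 * (1 - (1 + stumpff 1 x) / (4 * stumpff 2 x))"
  proof -
    have "\<forall>\<^sub>F x in nhds s. 0 < x"
      by (rule order_tendstoD(1) [OF filterlim_ident \<open>s > 0\<close>])
    moreover have "(stumpff 2 \<longlongrightarrow> stumpff 2 s) (nhds s)"
      using continuous_stumpff by (simp add: isCont_def tendsto_at_iff_tendsto_nhds)
    then have "\<forall>\<^sub>F x in nhds s. stumpff 2 x \<noteq> 0"
      using nz by (rule tendsto_imp_eventually_ne)
    ultimately show ?thesis by eventually_elim (rule B4_closed_form)
  qed
  ultimately have "(B4 has_real_derivative ?D) (at s)"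
    by (simp add: DERIV_cong_ev)
  then have D: "dB4 s = ?D" using B4_deriv [OF nz] DERIV_unique by blast
  have c: "stumpff 3 s = (1 - u) / s" "stumpff 4 s = (1 / 2 - v) / s"
    unfolding u_def v_def
    using stumpff_quotients [of s] \<open>s > 0\<close> by simp_all
  show ?thesis
    using assms unfolding D u_def [symmetric] v_def [symmetric] c
    by (simp add: divide_simps) (simp add: algebra_simps power2_eq_square power3_eq_cube)
qed

lemma bbar4_eq:
  assumes "beta t \<noteq> 0"
  shows "bbar4 t = 2 * dB4 (t\<^sup>2)"
  unfolding bbar4_def
proof (rule lim_ext_square_beta [OF _ assms])
  fix t :: real assume "t \<noteq> 0" and b: "beta t \<noteq> 0"
  have "stumpff 2 (t\<^sup>2) \<noteq> 0" using b stumpff_2_square [of t] by auto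
  then show "1 / (4 * t ^ 4) + 1 / t ^ 6 *
     (1 / (2 * beta t) + 3 / 2 * gamma t + gamma t / beta t + (gamma t)\<^sup>2 - 4) = 2 * dB4 (t\<^sup>2)"
    using bbar4_closed_form [of "t\<^sup>2"] \<open>t \<noteq> 0\<close>
    unfolding gamma_def stumpff_1_square [symmetric] stumpff_2_square [symmetric] by simp
next
  show "isCont (\<lambda>s. 2 * dB4 s) 0"
    unfolding dB4_def
    by (intro continuous_intros continuous_stumpff) (simp_all add: stumpff_at_0)
qed

section \<open>The adjoint matrices\<close>

lemma vec6_eqI: "upper A = upper B \<Longrightarrow> lower A = lower B \<Longrightarrow> A = B"
  unfolding vec_eq_iff upper_def lower_def by (auto simp: split_sum_all)

lemma upper_linear [simp]:
  "upper (A + B) = upper A + upper B" "upper (A - B) = upper A - upper B"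
  "upper (- A) = - upper A" "upper (c *\<^sub>R A) = c *\<^sub>R upper A" "upper 0 = 0"
  by (simp_all add: upper_def vec_eq_iff)

lemma lower_linear [simp]:
  "lower (A + B) = lower A + lower B" "lower (A - B) = lower A - lower B"
  "lower (- A) = - lower A" "lower (c *\<^sub>R A) = c *\<^sub>R lower A" "lower 0 = 0"
  by (simp_all add: lower_def vec_eq_iff)

lemma sum_UNIV_Plus: "(\<Sum>j\<in>(UNIV :: (3 + 3) set). f j) = (\<Sum>k\<in>UNIV. f (Inl k)) + (\<Sum>k\<in>UNIV. f (Inr k))"
  using sum.Plus [of "UNIV :: 3 set" "UNIV :: 3 set" f] by (simp add: comp_def)

lemma upper_ad: "upper (ad X *v V) = cross3 (upper X) (upper V)"
proof -
  have "upper (ad X *v V) = skew (upper X) *v upper V"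
    by (simp add: vec_eq_iff upper_def ad_def matrix_vector_mult_def sum_UNIV_Plus)
  then show ?thesis by (simp add: skew_mult)
qed

lemma lower_ad: "lower (ad X *v V) = cross3 (lower X) (upper V) + cross3 (upper X) (lower V)"
proof -
  have "lower (ad X *v V) = skew (lower X) *v upper V + skew (upper X) *v lower V"
    by (simp add: vec_eq_iff upper_def lower_def ad_def matrix_vector_mult_def sum_UNIV_Plus)
  then show ?thesis by (simp add: skew_mult)
qed

text \<open>
  \<open>ad U *v V\<close> is the Lie bracket of \<open>se(3)\<close>, hence antisymmetric.
\<close>

lemma ad_skew: "ad U *v V = - (ad V *v U)"
proof (rule vec6_eqI)
  show "upper (ad U *v V) = upper (- (ad V *v U))"
    using cross_skew [of "upper U" "upper V"] by (simp add: upper_ad)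
  show "lower (ad U *v V) = lower (- (ad V *v U))"
    using cross_skew [of "upper U" "lower V"] cross_skew [of "lower U" "upper V"]
    by (simp add: lower_ad)
qed

lemma cross_Jacobi: "cross3 (cross3 x v) w = cross3 x (cross3 v w) - cross3 v (cross3 x w)"
  by (simp add: cross3_simps)

text \<open>
  The Jacobi identity of \<open>se(3)\<close>, inherited from that of the cross product in both blocks.
\<close>

lemma ad_Jacobi: "ad (ad X *v V) *v W = ad X *v (ad V *v W) - ad V *v (ad X *v W)"
  by (rule vec6_eqI)
     (simp_all add: upper_ad lower_ad cross_Jacobi cross_add_left cross_add_right)

lemma bounded_bilinear_ad: "bounded_bilinear (\<lambda>X V. ad X *v V)"
  unfolding bilinear_conv_bounded_bilinear [symmetric] bilinear_def
proof (intro conjI allI)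
  show "linear (\<lambda>V. ad X *v V)" for X by simp
  show "linear (\<lambda>X. ad X *v V)" for V
  proof -
    have "linear (\<lambda>X. - (ad V *v X))"
      by (intro linear_compose_neg) simp
    then show ?thesis by (subst ad_skew)
  qed
qed

lemma matrix_minus_vector: "(- M) *v v = - (M *v v)" for M :: "real ^ 'n ^ 'm"
  using matrix_vector_mult_diff_rdistrib [of 0 M v] by simp

lemma matrix_vector_minus: "M *v (- v) = - (M *v v)" for M :: "real ^ 'n ^ 'm"
  using matrix_vector_mult_diff_distrib [of M 0 v] by simp

lemmas matrix_vector_expand =
  matrix_vector_right_distrib matrix_vector_mult_diff_distrib matrix_vector_mult_scaleR
  matrix_vector_mult_add_rdistrib matrix_vector_mult_diff_rdistrib matrix_minus_vector matrix_vector_minus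
  scaleR_matrix_vector_assoc [symmetric] matrix_vector_mul_assoc [symmetric]

lemma ad_zero [simp]: "ad 0 = 0"
proof -
  interpret ad: bounded_bilinear "\<lambda>X V. ad X *v V" by (rule bounded_bilinear_ad)
  show ?thesis unfolding matrix_eq by (simp add: ad.zero_left)
qed

lemma cross_triple: "cross3 x (cross3 x (cross3 x u)) = - (x \<bullet> x) *\<^sub>R cross3 x u"
  by (simp add: cross3_simps)

text \<open>
  The upper block of \<open>N\<close> acts as \<open>x \<times> _\<close>, which satisfies \<open>M^3 + s M = 0\<close>. Hence \<open>P = N^3 V + s N V\<close> has
  zero upper part. Its lower part is orthogonal to \<open>x\<close>, and on such vectors \<open>N\<^sup>2 = - s\<close>. Together,
  \<open>(N\<^sup>2 + s) (N^3 + s N) = 0\<close>.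
\<close>

lemma ad_annihilating_polynomial:
  defines "N \<equiv> \<lambda>X V. ad X *v V"
  assumes "s = (norm (upper X))\<^sup>2"
  shows "N X (N X (N X (N X (N X V)))) = - (2 * s) *\<^sub>R N X (N X (N X V)) - s\<^sup>2 *\<^sub>R N X V"
proof -
  define x y where "x = upper X" and "y = lower X"
  have s: "s = x \<bullet> x" using assms by (simp add: x_def power2_norm_eq_inner)
  have upper_N: "upper (N X W) = cross3 x (upper W)" for W
    by (simp add: N_def upper_ad x_def)
  have lower_N: "lower (N X W) = cross3 y (upper W) + cross3 x (lower W)" for W
    by (simp add: N_def lower_ad x_def y_def)
  define P where "P = N X (N X (N X V)) + s *\<^sub>R N X V"
  have "upper P = 0"
    by (simp add: P_def upper_N cross_triple s)
  moreover have "x \<bullet> lower P = 0"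
    unfolding P_def s by (simp add: upper_N lower_N) (simp add: cross3_simps)
  ultimately have "N X (N X P) = - s *\<^sub>R P"
    by (intro vec6_eqI) (simp_all add: upper_N lower_N s Lagrange)
  moreover have "N X (N X P) = N X (N X (N X (N X (N X V)))) + s *\<^sub>R N X (N X (N X V))"
    by (simp add: P_def N_def matrix_vector_right_distrib matrix_vector_mult_scaleR)
  ultimately have "N X (N X (N X (N X (N X V)))) = - s *\<^sub>R P - s *\<^sub>R N X (N X (N X V))"
    by (simp add: eq_diff_eq)
  moreover have "(2 * s) *\<^sub>R W = s *\<^sub>R W + s *\<^sub>R W" for W :: vec6
    by (simp flip: scaleR_left_distrib)
  ultimately show ?thesis
    by (simp add: P_def scaleR_right_distrib power2_eq_square)
qed

lemma mpow_vector: "mpow A 0 *v v = v" "mpow A (Suc n) *v v = A *v (mpow A n *v v)"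
  by (simp_all add: matrix_vector_mul_assoc)

lemma mpow_numeral_vector:
  "mpow A 1 *v v = A *v v" "mpow A 2 *v v = A *v (A *v v)"
  "mpow A 3 *v v = A *v (A *v (A *v v))" "mpow A 4 *v v = A *v (A *v (A *v (A *v v)))"
  by (simp_all add: eval_nat_numeral mpow_vector del: mpow.simps)

lemma Zi_simps:
  "Zi X Z 1 = ad X *v Z" "Zi X Z 2 = ad X *v (ad X *v Z)"
  "Zi X Z 3 = ad X *v (ad X *v (ad X *v Z))" "Zi X Z 4 = ad X *v (ad X *v (ad X *v (ad X *v Z)))"
  unfolding Zi_def by (rule mpow_numeral_vector)+

section \<open>Differentiating radial polynomials in ad\<close>

text \<open>
  The common shape of the two Jacobians, for arbitrary coefficients. The inverse is the case
  \<open>p\<^sub>3 = q\<^sub>1 = q\<^sub>3 = 0\<close>.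
\<close>

definition jac_form :: "real \<Rightarrow> real \<Rightarrow> real \<Rightarrow> real \<Rightarrow> real \<Rightarrow> real \<Rightarrow> real \<Rightarrow> real \<Rightarrow> vec6 \<Rightarrow> vec6 \<Rightarrow> mat6" where
  "jac_form p1 p2 p3 p4 q1 q2 q3 q4 Z X =
          - (p1 *\<^sub>R ad Z)
          + p2 *\<^sub>R (ad Z ** ad X - 2 *\<^sub>R (ad X ** ad Z))
          - p3 *\<^sub>R (mpow (ad X) 2 ** ad Z + ad X ** ad (Zi X Z 1) + ad (Zi X Z 2))
          - p4 *\<^sub>R (mpow (ad X) 3 ** ad Z + ad X ** ad (Zi X Z 2)
                       + mpow (ad X) 2 ** ad (Zi X Z 1) + ad (Zi X Z 3))
          + (q1 *\<^sub>R col_row (Zi X Z 1) (row_upper X)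
             + q2 *\<^sub>R col_row (Zi X Z 2) (row_upper X)
             + q3 *\<^sub>R col_row (Zi X Z 3) (row_upper X)
             + q4 *\<^sub>R col_row (Zi X Z 4) (row_upper X))"

lemma col_row_vector: "col_row v (row_upper X) *v U = (upper X \<bullet> upper U) *\<^sub>R v"
  by (simp add: vec_eq_iff col_row_def row_upper_def upper_def matrix_vector_mult_def
      sum_UNIV_Plus inner_vec_def sum_distrib_left sum_distrib_right mult_ac)

text \<open>
  Applied to a direction \<open>U\<close>, every coefficient multiplies the derivative of the corresponding
  \<open>ad\<^sub>X^i Z\<close>. The term with \<open>p\<^sub>2\<close> takes this form by the Jacobi identity.
\<close>

lemma jac_form_vector:
  "jac_form p1 p2 p3 p4 q1 q2 q3 q4 Z X *v U =
     - p1 *\<^sub>R (ad Z *v U)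
     - p2 *\<^sub>R (ad (ad X *v Z) *v U + ad X *v (ad Z *v U))
     - p3 *\<^sub>R (ad (ad X *v (ad X *v Z)) *v U + ad X *v (ad (ad X *v Z) *v U) + ad X *v (ad X *v (ad Z *v U)))
     - p4 *\<^sub>R (ad (ad X *v (ad X *v (ad X *v Z))) *v U + ad X *v (ad (ad X *v (ad X *v Z)) *v U)
              + ad X *v (ad X *v (ad (ad X *v Z) *v U)) + ad X *v (ad X *v (ad X *v (ad Z *v U))))
     + (upper X \<bullet> upper U) *\<^sub>R (q1 *\<^sub>R (ad X *v Z) + q2 *\<^sub>R (ad X *v (ad X *v Z))
         + q3 *\<^sub>R (ad X *v (ad X *v (ad X *v Z))) + q4 *\<^sub>R (ad X *v (ad X *v (ad X *v (ad X *v Z)))))"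
proof -
  have "(ad Z ** ad X - 2 *\<^sub>R (ad X ** ad Z)) *v U = - (ad (ad X *v Z) *v U + ad X *v (ad Z *v U))"
    unfolding ad_Jacobi [of X Z U] scaleR_2 matrix_vector_expand by simp
  then show ?thesis
    unfolding jac_form_def Zi_simps
    by (simp add: matrix_vector_mult_add_rdistrib matrix_vector_mult_diff_rdistrib matrix_minus_vector matrix_vector_minus
        scaleR_matrix_vector_assoc [symmetric] col_row_vector mpow_numeral_vector
        matrix_vector_mul_assoc [symmetric] del: mpow.simps)
       (simp add: algebra_simps)
qed

text \<open>
  The product rule for the bracket, with \<open>ad U *v f X\<close> turned into \<open>- (ad (f X) *v U)\<close> so that the
  direction \<open>U\<close> is on the right. Iterating it yields the derivatives of all \<open>ad\<^sub>X^i Z\<close>.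
\<close>

lemma has_derivative_ad:
  assumes "(f has_derivative f') (at X)"
  shows "((\<lambda>X. ad X *v f X) has_derivative (\<lambda>U. ad X *v f' U - ad (f X) *v U)) (at X)"
  using bounded_bilinear.FDERIV [OF bounded_bilinear_ad has_derivative_ident assms]
  by (simp add: ad_skew [of _ "f X"])

lemma has_derivative_norm_square_upper:
  "((\<lambda>X. (norm (upper X))\<^sup>2) has_derivative (\<lambda>U. 2 * (upper X \<bullet> upper U))) (at X)"
proof -
  have "bounded_linear upper"
    by (intro linear_conv_bounded_linear [THEN iffD1] linearI) simp_all
  then have "(upper has_derivative upper) (at X)"
    by (rule bounded_linear.has_derivative [OF _ has_derivative_ident, simplified])
  from has_derivative_inner [OF this this] show ?thesis
    by (simp add: power2_norm_eq_inner inner_commute)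
qed

text \<open>
  The derivative of \<open>p\<close> is written as \<open>q / 2\<close> because the squared norm contributes a factor two: with
  this convention \<open>q\<close> is exactly the barred coefficient.
\<close>

lemma has_derivative_radial_scaleR:
  assumes "(p has_real_derivative q / 2) (at ((norm (upper X))\<^sup>2))"
    and "(f has_derivative f') (at X)"
  shows "((\<lambda>X. p ((norm (upper X))\<^sup>2) *\<^sub>R f X) has_derivative
      (\<lambda>U. p ((norm (upper X))\<^sup>2) *\<^sub>R f' U + (q * (upper X \<bullet> upper U)) *\<^sub>R f X)) (at X)"
proof -
  have "((\<lambda>X. p ((norm (upper X))\<^sup>2)) has_derivative (\<lambda>U. q / 2 * (2 * (upper X \<bullet> upper U)))) (at X)"
    by (rule has_derivative_compose [OF has_derivative_norm_square_upper])
       (use assms(1) in \<open>simp only: has_field_derivative_def\<close>)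
  from has_derivative_scaleR [OF this assms(2)] show ?thesis by (simp add: mult_ac)
qed

lemma has_derivative_ad_polynomial:
  fixes Z X :: vec6
  defines "s \<equiv> \<lambda>X. (norm (upper X))\<^sup>2"
  assumes "(p1 has_real_derivative q1 / 2) (at (s X))" "(p2 has_real_derivative q2 / 2) (at (s X))"
    "(p3 has_real_derivative q3 / 2) (at (s X))" "(p4 has_real_derivative q4 / 2) (at (s X))"
  shows "((\<lambda>X. Z + p1 (s X) *\<^sub>R Zi X Z 1 + p2 (s X) *\<^sub>R Zi X Z 2
            + p3 (s X) *\<^sub>R Zi X Z 3 + p4 (s X) *\<^sub>R Zi X Z 4) has_derivative
      (\<lambda>U. jac_form (p1 (s X)) (p2 (s X)) (p3 (s X)) (p4 (s X)) q1 q2 q3 q4 Z X *v U)) (at X)"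
proof -
  note D1 = has_derivative_ad [OF has_derivative_const [of Z "at X"]]
  note D2 = has_derivative_ad [OF D1]
  note D3 = has_derivative_ad [OF D2]
  note D4 = has_derivative_ad [OF D3]
  show ?thesis
    unfolding Zi_simps s_def
    by (rule has_derivative_eq_rhs [OF has_derivative_add [OF has_derivative_add [OF has_derivative_add
          [OF has_derivative_add [OF has_derivative_const
            has_derivative_radial_scaleR [OF assms(2) [unfolded s_def] D1]]
            has_derivative_radial_scaleR [OF assms(3) [unfolded s_def] D2]]
            has_derivative_radial_scaleR [OF assms(4) [unfolded s_def] D3]]
            has_derivative_radial_scaleR [OF assms(5) [unfolded s_def] D4]]])
       (rule ext, simp add: jac_form_vector matrix_vector_minus algebra_simps)
qed

lemma jacobian_unique:
  fixes J :: "real ^ 'n ^ 'm"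
  shows "(f has_derivative (\<lambda>U. J *v U)) (at X) \<Longrightarrow> f differentiable (at X) \<and> jacobian f (at X) = J"
  using frechet_derivative_at [of f "\<lambda>U. J *v U" X] matrix_of_matrix_vector_mul [of J]
  by (auto simp: jacobian_def differentiable_def)

lemma jac_form_at_0: "jac_form p1 p2 p3 p4 q1 q2 q3 q4 Z 0 = - p1 *\<^sub>R ad Z"
  unfolding matrix_eq jac_form_vector
  by (simp add: matrix_minus_vector flip: scaleR_matrix_vector_assoc)

lemma matrix_tendstoI:
  fixes M :: "'a \<Rightarrow> real ^ 'n ^ 'm"
  assumes "\<And>v. ((\<lambda>x. M x *v v) \<longlongrightarrow> L *v v) F"
  shows "(M \<longlongrightarrow> L) F"
proof (intro vec_tendstoI)
  fix i j
  have "((\<lambda>x. (M x *v axis j 1) $ i) \<longlongrightarrow> (L *v axis j 1) $ i) F"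
    by (intro tendsto_vec_nth assms)
  then show "((\<lambda>x. M x $ i $ j) \<longlongrightarrow> L $ i $ j) F"
    by (simp add: matrix_vector_mult_basis column_def)
qed

lemma tendsto_upper: "(upper \<longlongrightarrow> upper 0) (at 0)"
  unfolding upper_def by (intro tendsto_intros)

lemma tendsto_norm_upper_square: "((\<lambda>X. (norm (upper X))\<^sup>2) \<longlongrightarrow> 0) (at 0)"
proof -
  have "((\<lambda>X. (norm (upper X))\<^sup>2) \<longlongrightarrow> (norm (upper 0))\<^sup>2) (at 0)"
    by (intro tendsto_intros tendsto_upper)
  then show ?thesis by simp
qed

lemma jac_form_tendsto:
  fixes Z :: vec6
  defines "s \<equiv> \<lambda>X. (norm (upper X))\<^sup>2"
  assumes "isCont p1 0" "isCont p2 0" "isCont p3 0" "isCont p4 0"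
    "isCont q1 0" "isCont q2 0" "isCont q3 0" "isCont q4 0"
  shows "((\<lambda>X. jac_form (p1 (s X)) (p2 (s X)) (p3 (s X)) (p4 (s X))
      (q1 (s X)) (q2 (s X)) (q3 (s X)) (q4 (s X)) Z X) \<longlongrightarrow> - p1 0 *\<^sub>R ad Z) (at 0)"
proof -
  interpret ad: bounded_bilinear "\<lambda>X V. ad X *v V" by (rule bounded_bilinear_ad)
  have id: "((\<lambda>X. X) \<longlongrightarrow> (0 :: vec6)) (at 0)" by (rule tendsto_ident_at)
  have s: "(s \<longlongrightarrow> 0) (at 0)"
    unfolding s_def by (rule tendsto_norm_upper_square)
  have p: "((\<lambda>X. p (s X)) \<longlongrightarrow> p 0) (at 0)" if "isCont p 0" for p :: "real \<Rightarrow> real"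
    using isCont_tendsto_compose [OF that s] .
  show ?thesis
  proof (rule matrix_tendstoI)
    fix U
    show "((\<lambda>X. jac_form (p1 (s X)) (p2 (s X)) (p3 (s X)) (p4 (s X))
        (q1 (s X)) (q2 (s X)) (q3 (s X)) (q4 (s X)) Z X *v U) \<longlongrightarrow> (- p1 0 *\<^sub>R ad Z) *v U) (at 0)"
      unfolding jac_form_at_0 [symmetric, of "p1 0" Z "p2 0" "p3 0" "p4 0" "q1 0" "q2 0" "q3 0" "q4 0"]
        jac_form_vector
      by (intro tendsto_intros ad.tendsto p assms tendsto_upper id)
  qed
qed

section \<open>The closed form of dexp\<close>

lemma mpow_ad_plus_5:
  assumes "s = (norm (upper X))\<^sup>2"
  shows "mpow (ad X) (n + 5) = - (2 * s) *\<^sub>R mpow (ad X) (n + 3) - s\<^sup>2 *\<^sub>R mpow (ad X) (n + 1)"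
proof (induction n)
  case 0
  show ?case
    unfolding matrix_eq matrix_vector_mult_diff_rdistrib scaleR_matrix_vector_assoc [symmetric]
    using ad_annihilating_polynomial [OF assms]
    by (simp add: eval_nat_numeral mpow_vector del: mpow.simps)
next
  case (Suc n)
  show ?case
    unfolding add_Suc mpow.simps Suc.IH matrix_eq matrix_vector_expand by simp
qed

text \<open>
  Powers of the same parity reduce to two of them. The roots \<open>\<plusminus> \<i> \<phi>\<close> of the annihilating polynomial are
  double, which is why the coefficients are of the form \<open>(linear in n) * (- s)^n\<close>. At \<open>n = 0\<close> the truncated
  exponent \<open>n - 1\<close> is harmless because of the factor \<open>n\<close>.
\<close>

lemma mpow_ad_reduce:
  assumes "s = (norm (upper X))\<^sup>2"
  shows "mpow (ad X) (2 * n + k + 1) = ((1 - real n) * (- s) ^ n) *\<^sub>R mpow (ad X) (k + 1)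
    + (real n * (- s) ^ (n - 1)) *\<^sub>R mpow (ad X) (k + 3)"
proof (induction n rule: induct_nat_012)
  case 0
  show ?case by simp
next
  case 1
  show ?case by (simp add: eval_nat_numeral)
next
  case (ge2 n)
  let ?N = "mpow (ad X)"
  have "?N (2 * Suc (Suc n) + k + 1) = ?N ((2 * n + k) + 5)"
    by (rule arg_cong [of _ _ ?N]) simp
  also have "\<dots> = - (2 * s) *\<^sub>R ?N (2 * n + k + 3) - s\<^sup>2 *\<^sub>R ?N (2 * n + k + 1)"
    by (rule mpow_ad_plus_5 [OF assms])
  also have "?N (2 * n + k + 3) = ?N (2 * Suc n + k + 1)"
    by (rule arg_cong [of _ _ ?N]) simp
  also have "- (2 * s) *\<^sub>R \<dots> - s\<^sup>2 *\<^sub>R ?N (2 * n + k + 1) =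
      (- (2 * s) * ((1 - real (Suc n)) * (- s) ^ Suc n) - s\<^sup>2 * ((1 - real n) * (- s) ^ n)) *\<^sub>R ?N (k + 1)
      + (- (2 * s) * (real (Suc n) * (- s) ^ n) - s\<^sup>2 * (real n * (- s) ^ (n - 1))) *\<^sub>R ?N (k + 3)"
    unfolding ge2 by (simp add: scaleR_left_diff_distrib scaleR_right_distrib del: of_nat_Suc power_Suc)
  also have "- (2 * s) * ((1 - real (Suc n)) * (- s) ^ Suc n) - s\<^sup>2 * ((1 - real n) * (- s) ^ n)
      = (1 - real (Suc (Suc n))) * (- s) ^ Suc (Suc n)"
    by (simp add: algebra_simps power2_eq_square)
  also have "- (2 * s) * (real (Suc n) * (- s) ^ n) - s\<^sup>2 * (real n * (- s) ^ (n - 1))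
      = real (Suc (Suc n)) * (- s) ^ (Suc (Suc n) - 1)"
    by (cases n) (simp_all add: algebra_simps power2_eq_square)
  finally show ?case .
qed

text \<open>
  In the exponential series of \<open>N = ad X\<close> the odd powers contribute multiples of \<open>N\<close> and \<open>N^3\<close>, the even
  ones multiples of \<open>N\<^sup>2\<close> and \<open>N^4\<close>; one instance sums the pair \<open>N, N\<^sup>2\<close>, another the pair \<open>N^3, N^4\<close>.
\<close>

lemma sums_interleave_scaleR:
  fixes A B :: "'a :: real_normed_vector"
  assumes "f sums x" "g sums y"
  shows "(\<lambda>i. if even i then f (i div 2) *\<^sub>R A else g (i div 2) *\<^sub>R B) sums (x *\<^sub>R A + y *\<^sub>R B)"
proof -
  have "(\<lambda>i. if even i then f (i div 2) else 0) sums x"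
    using sums_if [OF sums_zero assms(1)] by simp
  moreover have "(\<lambda>i. if even i then 0 else g (i div 2)) sums y"
  proof -
    have "(\<lambda>i. if even i then 0 else g ((i - 1) div 2)) = (\<lambda>i. if even i then 0 else g (i div 2))"
      by (rule ext) (auto elim!: oddE)
    then show ?thesis using sums_if' [OF assms(2)] by simp
  qed
  ultimately have "(\<lambda>i. (if even i then f (i div 2) else 0) *\<^sub>R A + (if even i then 0 else g (i div 2)) *\<^sub>R B)
      sums (x *\<^sub>R A + y *\<^sub>R B)"
    by (intro sums_add bounded_linear.sums [OF bounded_linear_scaleR_left])
  moreover have "(\<lambda>i. (if even i then f (i div 2) else 0) *\<^sub>R A + (if even i then 0 else g (i div 2)) *\<^sub>R B)
      = (\<lambda>i. if even i then f (i div 2) *\<^sub>R A else g (i div 2) *\<^sub>R B)"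
    by auto
  ultimately show ?thesis by simp
qed

lemma dexp_closed_form:
  fixes X :: vec6
  defines "t \<equiv> norm (upper X)"
  shows "dexp X = mat 1 + a1 t *\<^sub>R mpow (ad X) 1 + a2 t *\<^sub>R mpow (ad X) 2
    + a3 t *\<^sub>R mpow (ad X) 3 + a4 t *\<^sub>R mpow (ad X) 4"
proof -
  let ?N = "mpow (ad X)"
  define s where "s = t\<^sup>2"
  have s: "s = (norm (upper X))\<^sup>2" by (simp add: s_def t_def)
  \<comment> \<open>The coefficients that reducing the powers produces, divided by the factorials of the exponential series: \<open>k = 2\<close> belongs to the odd powers, \<open>k = 3\<close> to the even ones.\<close>
  define u where "u = (\<lambda>k n. (1 - real n) * (- s) ^ n / fact (2 * n + k))"
  define w where "w = (\<lambda>k n. real n * (- s) ^ (n - 1) / fact (2 * n + k))"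
  have a: "u 2 sums a1 t" "u 3 sums a2 t" "w 2 sums a3 t" "w 3 sums a4 t"
  proof -
    have w2: "stumpff (2 + 1) s - real 2 * stumpff (2 + 2) s = stumpff 3 s - 2 * stumpff 4 s"
      and w3: "stumpff (3 + 1) s - real 3 * stumpff (3 + 2) s = stumpff 4 s - 3 * stumpff 5 s"
      by simp_all
    have u2: "stumpff 2 s + s * ((stumpff 3 s - 2 * stumpff 4 s) / 2) = 2 * stumpff 2 s - stumpff 1 s / 2"
      using stumpff_mults(1,2) [of s] by (simp add: right_diff_distrib)
    have u3: "stumpff 3 s + s * ((stumpff 4 s - 3 * stumpff 5 s) / 2) = (5 * stumpff 3 s - stumpff 2 s) / 2"
      using stumpff_mults(2,3) [of s] by (simp add: right_diff_distrib)
    show "w 2 sums a3 t"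
      unfolding w_def a3_eq s_def [symmetric] w2 [symmetric] by (rule stumpff_weighted_sums)
    show "w 3 sums a4 t"
      unfolding w_def a4_eq s_def [symmetric] w3 [symmetric] by (rule stumpff_weighted_sums)
    show "u 2 sums a1 t"
      unfolding u_def a1_eq s_def [symmetric] u2 [symmetric] w2 [symmetric] by (rule stumpff_complementary_sums)
    show "u 3 sums a2 t"
      unfolding u_def a2_eq s_def [symmetric] u3 [symmetric] w3 [symmetric] by (rule stumpff_complementary_sums)
  qed
  have split: "(1 / fact (Suc i + 1)) *\<^sub>R ?N (Suc i) =
      (if even i then u 2 (i div 2) *\<^sub>R ?N 1 else u 3 (i div 2) *\<^sub>R ?N 2)
      + (if even i then w 2 (i div 2) *\<^sub>R ?N 3 else w 3 (i div 2) *\<^sub>R ?N 4)" for i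
  proof (cases "even i")
    case True
    then obtain n where n: "i = 2 * n" by blast
    have "(1 / fact (2 * n + 2)) *\<^sub>R ?N (2 * n + 0 + 1) = u 2 n *\<^sub>R ?N (0 + 1) + w 2 n *\<^sub>R ?N (0 + 3)"
      unfolding mpow_ad_reduce [OF s] scaleR_right_distrib scaleR_scaleR u_def w_def by (simp del: fact_Suc)
    then show ?thesis by (simp add: n del: fact_Suc mpow.simps)
  next
    case False
    then obtain n where n: "i = 2 * n + 1" by (blast elim: oddE)
    have "(1 / fact (2 * n + 3)) *\<^sub>R ?N (2 * n + 1 + 1) = u 3 n *\<^sub>R ?N (1 + 1) + w 3 n *\<^sub>R ?N (1 + 3)"
      unfolding mpow_ad_reduce [OF s] scaleR_right_distrib scaleR_scaleR u_def w_def by (simp del: fact_Suc)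
    moreover have "Suc i + 1 = 2 * n + 3" "Suc i = 2 * n + 1 + 1" "i div 2 = n" "odd i"
      "(1 + 1 :: nat) = 2" "(1 + 3 :: nat) = 4"
      using n by simp_all
    ultimately show ?thesis by (simp only: if_False)
  qed
  have "(\<lambda>i. (1 / fact (Suc i + 1)) *\<^sub>R ?N (Suc i)) sums
      (a1 t *\<^sub>R ?N 1 + a2 t *\<^sub>R ?N 2 + (a3 t *\<^sub>R ?N 3 + a4 t *\<^sub>R ?N 4))"
    unfolding split by (intro sums_add sums_interleave_scaleR a)
  from sums_Suc [OF this] have "(\<lambda>i. (1 / fact (i + 1)) *\<^sub>R ?N i) sums
      (a1 t *\<^sub>R ?N 1 + a2 t *\<^sub>R ?N 2 + (a3 t *\<^sub>R ?N 3 + a4 t *\<^sub>R ?N 4) + mat 1)"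
    by simp
  then show ?thesis
    unfolding dexp_def sums_iff by (simp add: algebra_simps del: mpow.simps)
qed

section \<open>The closed form of the inverse\<close>

text \<open>
  With \<open>\<alpha>\<^sub>i\<close> and \<open>\<beta>\<^sub>i\<close> standing for the coefficients \<open>a\<^sub>i\<close> and \<open>b\<^sub>i\<close> scaled by powers of \<open>s\<close>, the
  conditions for the product to be the identity become polynomial identities in \<open>u = c\<^sub>1\<close>, \<open>v = c\<^sub>2\<close> and
  \<open>r = 1 / c\<^sub>2\<close>; here \<open>w = s v\<close>, and \<open>w = 2 - u\<^sup>2 r\<close> is the Pythagorean identity.
\<close>

lemma inverse_coefficients_scaled:
  fixes r s u v w \<alpha>1 \<alpha>2 \<alpha>3 \<alpha>4 \<beta>2 \<beta>4 :: real
  assumes "r * v = 1" "w = 2 - u\<^sup>2 * r" "s = w * r"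
    and "\<alpha>1 = 2 * v - u / 2" "2 * \<alpha>2 = 5 - 5 * u - w" "\<alpha>3 = v - u / 2" "2 * \<alpha>4 = 3 - 3 * u - w"
    and "4 * \<beta>2 = 8 - (1 + 3 * u) * r" "4 * \<beta>4 = 4 - (1 + u) * r"
  shows "\<alpha>1 - 1 / 2 - (\<alpha>1 * \<beta>4 + \<alpha>3 * \<beta>2 - \<alpha>4 / 2) + 2 * \<alpha>3 * \<beta>4 = 0"
    and "\<alpha>2 - s * \<alpha>1 / 2 + \<beta>2 - (\<alpha>4 * \<beta>2 + \<alpha>2 * \<beta>4) + 2 * \<alpha>4 * \<beta>4 = 0"
    and "\<alpha>3 - \<alpha>2 / 2 + \<alpha>1 * \<beta>2 - 2 * (\<alpha>1 * \<beta>4 + \<alpha>3 * \<beta>2 - \<alpha>4 / 2) + 3 * \<alpha>3 * \<beta>4 = 0"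
    and "\<alpha>4 - s * \<alpha>3 / 2 + \<alpha>2 * \<beta>2 + \<beta>4 - 2 * (\<alpha>4 * \<beta>2 + \<alpha>2 * \<beta>4) + 3 * \<alpha>4 * \<beta>4 = 0"
  using assms by algebra+

text \<open>
  The left-hand sides are the coefficients of \<open>N, ..., N^4\<close> in
  \<open>(I + a\<^sub>1 N + ... + a\<^sub>4 N^4) (I - N / 2 + b\<^sub>2 N\<^sup>2 + b\<^sub>4 N^4)\<close> after the powers above the fourth have been reduced.
  For \<open>s > 0\<close> the scaled identities apply; at \<open>s = 0\<close>, where scaling loses information, all values are
  explicit rationals.
\<close>

lemma inverse_coefficients:
  fixes t :: real
  defines "s \<equiv> t\<^sup>2"
  assumes "beta t \<noteq> 0"
  shows "a1 t - 1 / 2 - s\<^sup>2 * (a1 t * B4 s + a3 t * B2 s - a4 t / 2) + 2 * s ^ 3 * (a3 t * B4 s) = 0" (is "?e1 = 0")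
    and "a2 t - a1 t / 2 + B2 s - s\<^sup>2 * (a4 t * B2 s + a2 t * B4 s) + 2 * s ^ 3 * (a4 t * B4 s) = 0" (is "?e2 = 0")
    and "a3 t - a2 t / 2 + a1 t * B2 s - 2 * s * (a1 t * B4 s + a3 t * B2 s - a4 t / 2)
          + 3 * s\<^sup>2 * (a3 t * B4 s) = 0" (is "?e3 = 0")
    and "a4 t - a3 t / 2 + a2 t * B2 s + B4 s - 2 * s * (a4 t * B2 s + a2 t * B4 s)
          + 3 * s\<^sup>2 * (a4 t * B4 s) = 0" (is "?e4 = 0")
proof -
  define u where "u = stumpff 1 s"
  define v where "v = stumpff 2 s"
  have nz: "v \<noteq> 0" using assms stumpff_2_square [of t] by (auto simp: v_def)
  have "?e1 = 0 \<and> ?e2 = 0 \<and> ?e3 = 0 \<and> ?e4 = 0"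
  proof (cases "t = 0")
    case True
    then show ?thesis
      by (simp add: a1_eq a2_eq a3_eq a4_eq B2_def B4_def s_def stumpff_at_0 fact_numeral power2_eq_square
          del: One_nat_def)
  next
    case False
    then have "s > 0" by (simp add: s_def)
    define r where "r = 1 / v"
    have rel: "r * v = 1" "s * v = 2 - u\<^sup>2 * r" "s = (s * v) * r"
      using nz stumpff_pythagoras [of s, folded u_def v_def] \<open>s > 0\<close>
      by (simp_all add: r_def field_simps power2_eq_square)
    note m = stumpff_mults [of s, folded u_def v_def]
    have \<alpha>1: "a1 t = 2 * v - u / 2"
      by (simp add: a1_eq u_def v_def s_def)
    have \<alpha>2: "2 * (s * a2 t) = 5 - 5 * u - s * v"
      using m(1) by (simp add: a2_eq u_def v_def s_def [symmetric] right_diff_distrib)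
    have \<alpha>3: "s * a3 t = v - u / 2"
      using m(1,2) by (simp add: a3_eq u_def v_def s_def [symmetric] right_diff_distrib)
    have "2 * (s * a4 t) = 3 * stumpff 3 s - v"
      using m(2,3) by (simp add: a4_eq u_def v_def s_def [symmetric] right_diff_distrib)
    then have "s * (2 * (s * a4 t)) = 3 * (s * stumpff 3 s) - s * v"
      by (simp add: right_diff_distrib)
    then have \<alpha>4: "2 * (s\<^sup>2 * a4 t) = 3 - 3 * u - s * v"
      unfolding m by (simp add: power2_eq_square mult_ac)
    have "4 * (s * B2 s) = (s * (3 * stumpff 3 s - 8 * stumpff 4 s)) * r"
      by (simp add: B2_def r_def v_def)
    also have "\<dots> = (3 * (s * stumpff 3 s) - 8 * (s * stumpff 4 s)) * r"
      by (simp add: algebra_simps)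
    also have "\<dots> = 8 * (r * v) - (1 + 3 * u) * r"
      unfolding m by (simp add: algebra_simps)
    finally have \<beta>2: "4 * (s * B2 s) = 8 - (1 + 3 * u) * r"
      unfolding rel(1) by simp
    have \<beta>4: "4 * (s\<^sup>2 * B4 s) = 4 - (1 + u) * r"
    proof -
      have *: "s\<^sup>2 * B4 s = 1 - (1 + u) / (4 * v)"
        using B4_closed_form [of s, folded u_def v_def] \<open>s > 0\<close> nz by simp
      show ?thesis unfolding * r_def using nz by (simp add: field_simps)
    qed
    note E = inverse_coefficients_scaled [OF rel \<alpha>1 \<alpha>2 \<alpha>3 \<alpha>4 \<beta>2 \<beta>4]
    have "?e1 = 0" using E(1) by algebra
    moreover have "s * ?e2 = 0" using E(2) by algebra
    moreover have "s * ?e3 = 0" using E(3) by algebra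
    moreover have "s\<^sup>2 * ?e4 = 0" using E(4) by algebra
    ultimately show ?thesis using \<open>s > 0\<close> by simp
  qed
  then show "?e1 = 0" "?e2 = 0" "?e3 = 0" "?e4 = 0" by simp_all
qed

text \<open>
  The vectors \<open>z\<^sub>1, ..., z\<^sub>4\<close> are \<open>N v, ..., N^4 v\<close>; since \<open>N z\<^sub>4\<close> is a combination of them, the product can be
  multiplied out in their span.
\<close>

lemma dexp_inverse_vector:
  fixes X v :: vec6
  defines "t \<equiv> norm (upper X)"
  defines "N \<equiv> \<lambda>w. ad X *v w"
  assumes "beta t \<noteq> 0"
  shows "dexp X *v (v - (1 / 2) *\<^sub>R N v + B2 (t\<^sup>2) *\<^sub>R N (N v) + B4 (t\<^sup>2) *\<^sub>R N (N (N (N v)))) = v"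
proof -
  define s where "s = t\<^sup>2"
  define z1 z2 z3 z4 where z: "z1 = N v" "z2 = N z1" "z3 = N z2" "z4 = N z3"
  have z5: "N z4 = - (2 * s) *\<^sub>R z3 - s\<^sup>2 *\<^sub>R z1"
    using ad_annihilating_polynomial [of s X v] unfolding z N_def s_def t_def by simp
  have lin: "N (x + y) = N x + N y" "N (x - y) = N x - N y" "N (c *\<^sub>R x) = c *\<^sub>R N x" for x y c
    by (simp_all add: N_def matrix_vector_expand)
  define w where "w = v - (1 / 2) *\<^sub>R z1 + B2 s *\<^sub>R z2 + B4 s *\<^sub>R z4"
  note fold_z = z [symmetric] z5
  have w1: "N w = (1 - s\<^sup>2 * B4 s) *\<^sub>R z1 - (1 / 2) *\<^sub>R z2 + (B2 s - 2 * s * B4 s) *\<^sub>R z3"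
    unfolding w_def lin fold_z by (simp add: algebra_simps)
  have w2: "N (N w) = (1 - s\<^sup>2 * B4 s) *\<^sub>R z2 - (1 / 2) *\<^sub>R z3 + (B2 s - 2 * s * B4 s) *\<^sub>R z4"
    unfolding w1 lin fold_z ..
  have w3: "N (N (N w)) = (1 - s\<^sup>2 * B4 s) *\<^sub>R z3 - (1 / 2) *\<^sub>R z4
      + (B2 s - 2 * s * B4 s) *\<^sub>R (- (2 * s) *\<^sub>R z3 - s\<^sup>2 *\<^sub>R z1)"
    unfolding w2 lin fold_z ..
  have w4: "N (N (N (N w))) = (1 - s\<^sup>2 * B4 s) *\<^sub>R z4 - (1 / 2) *\<^sub>R (- (2 * s) *\<^sub>R z3 - s\<^sup>2 *\<^sub>R z1)
      + (B2 s - 2 * s * B4 s) *\<^sub>R (- (2 * s) *\<^sub>R z4 - s\<^sup>2 *\<^sub>R z2)"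
    unfolding w3 lin fold_z ..
  have "dexp X *v w = w + a1 t *\<^sub>R N w + a2 t *\<^sub>R N (N w) + a3 t *\<^sub>R N (N (N w)) + a4 t *\<^sub>R N (N (N (N w)))"
    unfolding dexp_closed_form t_def N_def
    by (simp add: matrix_vector_mult_add_rdistrib scaleR_matrix_vector_assoc [symmetric]
        mpow_numeral_vector del: mpow.simps One_nat_def)
  also have "\<dots> = v
      + (a1 t - 1 / 2 - s\<^sup>2 * (a1 t * B4 s + a3 t * B2 s - a4 t / 2) + 2 * s ^ 3 * (a3 t * B4 s)) *\<^sub>R z1
      + (a2 t - a1 t / 2 + B2 s - s\<^sup>2 * (a4 t * B2 s + a2 t * B4 s) + 2 * s ^ 3 * (a4 t * B4 s)) *\<^sub>R z2
      + (a3 t - a2 t / 2 + a1 t * B2 s - 2 * s * (a1 t * B4 s + a3 t * B2 s - a4 t / 2)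
          + 3 * s\<^sup>2 * (a3 t * B4 s)) *\<^sub>R z3
      + (a4 t - a3 t / 2 + a2 t * B2 s + B4 s - 2 * s * (a4 t * B2 s + a2 t * B4 s)
          + 3 * s\<^sup>2 * (a4 t * B4 s)) *\<^sub>R z4"
    unfolding w4 unfolding w3 unfolding w2 unfolding w1 unfolding w_def
    by (simp add: vec_eq_iff power2_eq_square power3_eq_cube)
       (simp add: algebra_simps add_divide_distrib diff_divide_distrib)
  also have "\<dots> = v"
    unfolding s_def inverse_coefficients [OF assms(3)] by simp
  finally show ?thesis unfolding w_def z s_def .
qed

lemma matrix_inv_eqI:
  fixes A B :: "real ^ 'n ^ 'n"
  assumes "A ** B = mat 1"
  shows "matrix_inv A = B"
proof -
  have BA: "B ** A = mat 1" using assms by (rule matrix_left_right_inverse1)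
  have "\<exists>A'. A ** A' = mat 1 \<and> A' ** A = mat 1" using assms BA by blast
  then have "A ** matrix_inv A = mat 1"
    unfolding matrix_inv_def by (rule someI2_ex) simp
  then have "B = B ** (A ** matrix_inv A)" by simp
  also have "\<dots> = matrix_inv A" by (simp add: matrix_mul_assoc BA)
  finally show ?thesis by simp
qed

lemma dexp_inv_closed_form:
  fixes X :: vec6
  defines "t \<equiv> norm (upper X)"
  assumes "beta t \<noteq> 0"
  shows "dexp_inv X = mat 1 - (1 / 2) *\<^sub>R mpow (ad X) 1 + B2 (t\<^sup>2) *\<^sub>R mpow (ad X) 2 + B4 (t\<^sup>2) *\<^sub>R mpow (ad X) 4"
  unfolding dexp_inv_def
proof (rule matrix_inv_eqI)
  show "dexp X ** (mat 1 - (1 / 2) *\<^sub>R mpow (ad X) 1 + B2 (t\<^sup>2) *\<^sub>R mpow (ad X) 2 + B4 (t\<^sup>2) *\<^sub>R mpow (ad X) 4) = mat 1"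
    unfolding matrix_eq
    using dexp_inverse_vector [OF assms(2) [unfolded t_def]]
    by (simp add: t_def matrix_vector_mul_assoc [symmetric] matrix_vector_mult_add_rdistrib
        matrix_vector_mult_diff_rdistrib scaleR_matrix_vector_assoc [symmetric]
        mpow_numeral_vector del: mpow.simps One_nat_def)
qed

section \<open>The Jacobians and their limits\<close>

text \<open>
  The barred coefficients are \<open>a\<^sub>i'(\<phi>) / \<phi>\<close>, which in terms of \<open>s = \<phi>\<^sup>2\<close> is twice the derivative.
\<close>

lemma a_coefficient_derivs:
  "((\<lambda>s. 2 * stumpff 2 s - stumpff 1 s / 2) has_real_derivative abar1 t / 2) (at (t\<^sup>2))"
  "((\<lambda>s. (5 * stumpff 3 s - stumpff 2 s) / 2) has_real_derivative abar2 t / 2) (at (t\<^sup>2))"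
  "((\<lambda>s. (stumpff 3 s - 2 * stumpff 4 s) / 2) has_real_derivative abar3 t / 2) (at (t\<^sup>2))"
  "((\<lambda>s. (stumpff 4 s - 3 * stumpff 5 s) / 2) has_real_derivative abar4 t / 2) (at (t\<^sup>2))"
proof -
  show "((\<lambda>s. 2 * stumpff 2 s - stumpff 1 s / 2) has_real_derivative abar1 t / 2) (at (t\<^sup>2))"
    unfolding abar1_eq by (rule derivative_eq_intros refl | simp)+ (simp add: field_simps)
  show "((\<lambda>s. (5 * stumpff 3 s - stumpff 2 s) / 2) has_real_derivative abar2 t / 2) (at (t\<^sup>2))"
    unfolding abar2_eq by (rule derivative_eq_intros refl | simp)+ (simp add: field_simps)
  show "((\<lambda>s. (stumpff 3 s - 2 * stumpff 4 s) / 2) has_real_derivative abar3 t / 2) (at (t\<^sup>2))"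
    unfolding abar3_eq by (rule derivative_eq_intros refl | simp)+ (simp add: field_simps)
  show "((\<lambda>s. (stumpff 4 s - 3 * stumpff 5 s) / 2) has_real_derivative abar4 t / 2) (at (t\<^sup>2))"
    unfolding abar4_eq by (rule derivative_eq_intros refl | simp)+ (simp add: field_simps)
qed

lemma jacobian_dexp:
  fixes X Z :: vec6
  defines "t \<equiv> norm (upper X)"
  shows "(\<lambda>X. dexp X *v Z) differentiable (at X) \<and> jacobian (\<lambda>X. dexp X *v Z) (at X) =
    jac_form (a1 t) (a2 t) (a3 t) (a4 t) (abar1 t) (abar2 t) (abar3 t) (abar4 t) Z X"
proof (rule jacobian_unique)
  have f: "dexp X *v Z = Z + a1 (norm (upper X)) *\<^sub>R Zi X Z 1 + a2 (norm (upper X)) *\<^sub>R Zi X Z 2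
      + a3 (norm (upper X)) *\<^sub>R Zi X Z 3 + a4 (norm (upper X)) *\<^sub>R Zi X Z 4" for X
    unfolding dexp_closed_form Zi_def
    by (simp add: matrix_vector_mult_add_rdistrib scaleR_matrix_vector_assoc [symmetric]
        del: mpow.simps One_nat_def)
  show "((\<lambda>X. dexp X *v Z) has_derivative
      (\<lambda>U. jac_form (a1 t) (a2 t) (a3 t) (a4 t) (abar1 t) (abar2 t) (abar3 t) (abar4 t) Z X *v U)) (at X)"
    using has_derivative_ad_polynomial [OF a_coefficient_derivs [of "norm (upper X)"], of Z]
    unfolding f t_def a1_eq a2_eq a3_eq a4_eq .
qed

text \<open>
  The closed form of the inverse is available only where \<open>c\<^sub>2 \<noteq> 0\<close>, which is an open condition, so it
  can still be differentiated there.
\<close>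

lemma jacobian_dexp_inv:
  fixes X Z :: vec6
  defines "t \<equiv> norm (upper X)"
  assumes "beta t \<noteq> 0"
  shows "(\<lambda>X. dexp_inv X *v Z) differentiable (at X) \<and> jacobian (\<lambda>X. dexp_inv X *v Z) (at X) =
    jac_form (b1 t) (b2 t) 0 (b4 t) (bbar1 t) (bbar2 t) (bbar3 t) (bbar4 t) Z X"
proof (rule jacobian_unique)
  let ?s = "\<lambda>X. (norm (upper X))\<^sup>2"
  let ?g = "\<lambda>X. Z + (- 1 / 2) *\<^sub>R Zi X Z 1 + B2 (?s X) *\<^sub>R Zi X Z 2
      + 0 *\<^sub>R Zi X Z 3 + B4 (?s X) *\<^sub>R Zi X Z 4"
  have nz: "stumpff 2 (?s X) \<noteq> 0"
    using assms stumpff_2_square [of t] by (auto simp: t_def)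
  have "((\<lambda>_. c) has_real_derivative 0 / 2) (at s)" for c s :: real
    by simp
  note has_derivative_ad_polynomial [OF this [of "- 1 / 2"], of B2 "bbar2 t" X "\<lambda>_. 0" 0 B4 "bbar4 t" Z]
  then have g: "(?g has_derivative
      (\<lambda>U. jac_form (b1 t) (b2 t) 0 (b4 t) (bbar1 t) (bbar2 t) (bbar3 t) (bbar4 t) Z X *v U)) (at X)"
    using B2_deriv [OF nz] B4_deriv [OF nz]
    unfolding b2_eq [OF assms(2)] b4_eq [OF assms(2)] bbar2_eq [OF assms(2)] bbar4_eq [OF assms(2)]
    by (simp add: b1_def bbar1_def bbar3_def t_def del: One_nat_def)
  have "continuous_on UNIV (\<lambda>X. stumpff 2 (?s X))"
    unfolding upper_def
    by (intro continuous_on_compose2 [OF continuous_at_imp_continuous_on [of UNIV "stumpff 2"]]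
        ballI continuous_stumpff continuous_intros) auto
  then have "open {X. stumpff 2 (?s X) \<noteq> 0}"
    by (rule open_Collect_neq [OF _ continuous_on_const])
  then show "((\<lambda>X. dexp_inv X *v Z) has_derivative
      (\<lambda>U. jac_form (b1 t) (b2 t) 0 (b4 t) (bbar1 t) (bbar2 t) (bbar3 t) (bbar4 t) Z X *v U)) (at X)"
  proof (rule has_derivative_transform_within_open [OF g])
    show "X \<in> {X. stumpff 2 (?s X) \<noteq> 0}" using nz by simp
    fix Y assume "Y \<in> {X. stumpff 2 (?s X) \<noteq> 0}"
    then have "beta (norm (upper Y)) \<noteq> 0" by (simp flip: stumpff_2_square)
    then show "?g Y = dexp_inv Y *v Z"
      unfolding dexp_inv_closed_form [OF \<open>beta (norm (upper Y)) \<noteq> 0\<close>] Zi_def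
      by (simp add: matrix_vector_mult_add_rdistrib matrix_vector_mult_diff_rdistrib
          scaleR_matrix_vector_assoc [symmetric] del: mpow.simps One_nat_def)
  qed
qed

lemma jacobian_dexp_tendsto:
  "((\<lambda>X. jacobian (\<lambda>X. dexp X *v Z) (at X)) \<longlongrightarrow> - (1 / 2) *\<^sub>R ad Z) (at 0)"
proof -
  have "((\<lambda>X. jacobian (\<lambda>X. dexp X *v Z) (at X)) \<longlongrightarrow>
      - (2 * stumpff 2 0 - stumpff 1 0 / 2) *\<^sub>R ad Z) (at 0)"
    unfolding jacobian_dexp [THEN conjunct2] a1_eq a2_eq a3_eq a4_eq abar1_eq abar2_eq abar3_eq abar4_eq
    by (rule jac_form_tendsto [where
          ?p1.0 = "\<lambda>s. 2 * stumpff 2 s - stumpff 1 s / 2"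
          and ?p2.0 = "\<lambda>s. (5 * stumpff 3 s - stumpff 2 s) / 2"
          and ?p3.0 = "\<lambda>s. (stumpff 3 s - 2 * stumpff 4 s) / 2"
          and ?p4.0 = "\<lambda>s. (stumpff 4 s - 3 * stumpff 5 s) / 2"
          and ?q1.0 = "\<lambda>s. (8 * stumpff 4 s - 5 * stumpff 3 s + stumpff 2 s) / 2"
          and ?q2.0 = "\<lambda>s. (15 * stumpff 5 s - 7 * stumpff 4 s + stumpff 3 s) / 2"
          and ?q3.0 = "\<lambda>s. (5 * stumpff 5 s - stumpff 4 s - 8 * stumpff 6 s) / 2"
          and ?q4.0 = "\<lambda>s. (7 * stumpff 6 s - stumpff 5 s - 15 * stumpff 7 s) / 2"])
       (intro continuous_intros continuous_stumpff; simp)+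
  then show ?thesis by (simp add: stumpff_at_0 del: One_nat_def)
qed

lemma isCont_dB2_dB4:
  "isCont dB2 0" "isCont dB4 0"
  unfolding dB2_def [abs_def] dB4_def [abs_def]
  by (intro continuous_intros continuous_stumpff; simp add: stumpff_at_0)+

lemma eventually_beta_upper_nonzero: "\<forall>\<^sub>F X in at 0. beta (norm (upper X)) \<noteq> 0"
proof -
  have "((\<lambda>X. stumpff 2 ((norm (upper X))\<^sup>2)) \<longlongrightarrow> stumpff 2 0) (at 0)"
    by (rule isCont_tendsto_compose [OF continuous_stumpff tendsto_norm_upper_square])
  then have "\<forall>\<^sub>F X in at 0. stumpff 2 ((norm (upper X))\<^sup>2) \<noteq> 0"
    by (rule tendsto_imp_eventually_ne) (simp add: stumpff_at_0)
  then show ?thesis by (simp flip: stumpff_2_square)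
qed

lemma jacobian_dexp_inv_tendsto:
  "((\<lambda>X. jacobian (\<lambda>X. dexp_inv X *v Z) (at X)) \<longlongrightarrow> (1 / 2) *\<^sub>R ad Z) (at 0)"
proof -
  let ?s = "\<lambda>X. (norm (upper X))\<^sup>2"
  have nz: "stumpff 2 0 \<noteq> 0" by (simp add: stumpff_at_0)
  have "((\<lambda>X. jac_form (- 1 / 2) (B2 (?s X)) 0 (B4 (?s X)) 0 (2 * dB2 (?s X)) 0 (2 * dB4 (?s X)) Z X)
      \<longlongrightarrow> - (- 1 / 2) *\<^sub>R ad Z) (at 0)"
    by (rule jac_form_tendsto [where ?p1.0 = "\<lambda>_. - 1 / 2" and ?p3.0 = "\<lambda>_. 0" and ?q1.0 = "\<lambda>_. 0"
          and ?q2.0 = "\<lambda>s. 2 * dB2 s" and ?q3.0 = "\<lambda>_. 0" and ?q4.0 = "\<lambda>s. 2 * dB4 s"])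
       (intro continuous_intros isCont_dB2_dB4 DERIV_isCont [OF B2_deriv [OF nz]] DERIV_isCont [OF B4_deriv [OF nz]])+
  moreover have "\<forall>\<^sub>F X in at 0.
      jac_form (- 1 / 2) (B2 (?s X)) 0 (B4 (?s X)) 0 (2 * dB2 (?s X)) 0 (2 * dB4 (?s X)) Z X
      = jacobian (\<lambda>X. dexp_inv X *v Z) (at X)"
    using eventually_beta_upper_nonzero
    by eventually_elim
       (simp add: jacobian_dexp_inv b1_def bbar1_def bbar3_def b2_eq b4_eq bbar2_eq bbar4_eq)
  ultimately show ?thesis
    using Lim_transform_eventually by fastforce
qed

theorem lemma3:
  fixes Z :: vec6
  shows
    "(\<forall>X. let \<phi> = norm (upper X) in
        (\<lambda>X. dexp X *v Z) differentiable (at X) \<and>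
        jacobian (\<lambda>X. dexp X *v Z) (at X) =
          - (a1 \<phi> *\<^sub>R ad Z)
          + a2 \<phi> *\<^sub>R (ad Z ** ad X - 2 *\<^sub>R (ad X ** ad Z))
          - a3 \<phi> *\<^sub>R (mpow (ad X) 2 ** ad Z + ad X ** ad (Zi X Z 1) + ad (Zi X Z 2))
          - a4 \<phi> *\<^sub>R (mpow (ad X) 3 ** ad Z + ad X ** ad (Zi X Z 2)
                       + mpow (ad X) 2 ** ad (Zi X Z 1) + ad (Zi X Z 3))
          + (abar1 \<phi> *\<^sub>R col_row (Zi X Z 1) (row_upper X)
             + abar2 \<phi> *\<^sub>R col_row (Zi X Z 2) (row_upper X)
             + abar3 \<phi> *\<^sub>R col_row (Zi X Z 3) (row_upper X)
             + abar4 \<phi> *\<^sub>R col_row (Zi X Z 4) (row_upper X)))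
   \<and> (\<forall>X. let \<phi> = norm (upper X) in beta \<phi> \<noteq> 0 \<longrightarrow>
        (\<lambda>X. dexp_inv X *v Z) differentiable (at X) \<and>
        jacobian (\<lambda>X. dexp_inv X *v Z) (at X) =
          - (b1 \<phi> *\<^sub>R ad Z)
          + b2 \<phi> *\<^sub>R (ad Z ** ad X - 2 *\<^sub>R (ad X ** ad Z))
          - b4 \<phi> *\<^sub>R (mpow (ad X) 3 ** ad Z + ad X ** ad (Zi X Z 2)
                       + mpow (ad X) 2 ** ad (Zi X Z 1) + ad (Zi X Z 3))
          + (bbar1 \<phi> *\<^sub>R col_row (Zi X Z 1) (row_upper X)
             + bbar2 \<phi> *\<^sub>R col_row (Zi X Z 2) (row_upper X)
             + bbar3 \<phi> *\<^sub>R col_row (Zi X Z 3) (row_upper X)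
             + bbar4 \<phi> *\<^sub>R col_row (Zi X Z 4) (row_upper X)))
   \<and> ((\<lambda>X. jacobian (\<lambda>X. dexp X *v Z) (at X)) \<longlongrightarrow> - (1 / 2) *\<^sub>R ad Z) (at 0)
   \<and> jacobian (\<lambda>X. dexp X *v Z) (at 0) = - (1 / 2) *\<^sub>R ad Z
   \<and> ((\<lambda>X. jacobian (\<lambda>X. dexp_inv X *v Z) (at X)) \<longlongrightarrow> (1 / 2) *\<^sub>R ad Z) (at 0)
   \<and> jacobian (\<lambda>X. dexp_inv X *v Z) (at 0) = (1 / 2) *\<^sub>R ad Z"
proof (intro conjI)
  show "\<forall>X. let \<phi> = norm (upper X) in
        (\<lambda>X. dexp X *v Z) differentiable (at X) \<and>
        jacobian (\<lambda>X. dexp X *v Z) (at X) =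
          - (a1 \<phi> *\<^sub>R ad Z)
          + a2 \<phi> *\<^sub>R (ad Z ** ad X - 2 *\<^sub>R (ad X ** ad Z))
          - a3 \<phi> *\<^sub>R (mpow (ad X) 2 ** ad Z + ad X ** ad (Zi X Z 1) + ad (Zi X Z 2))
          - a4 \<phi> *\<^sub>R (mpow (ad X) 3 ** ad Z + ad X ** ad (Zi X Z 2)
                       + mpow (ad X) 2 ** ad (Zi X Z 1) + ad (Zi X Z 3))
          + (abar1 \<phi> *\<^sub>R col_row (Zi X Z 1) (row_upper X)
             + abar2 \<phi> *\<^sub>R col_row (Zi X Z 2) (row_upper X)
             + abar3 \<phi> *\<^sub>R col_row (Zi X Z 3) (row_upper X)
             + abar4 \<phi> *\<^sub>R col_row (Zi X Z 4) (row_upper X))"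
    using jacobian_dexp [of Z] unfolding jac_form_def Let_def by blast
  show "\<forall>X. let \<phi> = norm (upper X) in beta \<phi> \<noteq> 0 \<longrightarrow>
        (\<lambda>X. dexp_inv X *v Z) differentiable (at X) \<and>
        jacobian (\<lambda>X. dexp_inv X *v Z) (at X) =
          - (b1 \<phi> *\<^sub>R ad Z)
          + b2 \<phi> *\<^sub>R (ad Z ** ad X - 2 *\<^sub>R (ad X ** ad Z))
          - b4 \<phi> *\<^sub>R (mpow (ad X) 3 ** ad Z + ad X ** ad (Zi X Z 2)
                       + mpow (ad X) 2 ** ad (Zi X Z 1) + ad (Zi X Z 3))
          + (bbar1 \<phi> *\<^sub>R col_row (Zi X Z 1) (row_upper X)
             + bbar2 \<phi> *\<^sub>R col_row (Zi X Z 2) (row_upper X)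
             + bbar3 \<phi> *\<^sub>R col_row (Zi X Z 3) (row_upper X)
             + bbar4 \<phi> *\<^sub>R col_row (Zi X Z 4) (row_upper X))"
    using jacobian_dexp_inv [of _ Z] unfolding jac_form_def Let_def scaleR_zero_left diff_0_right by blast
  have "a1 0 = 1 / 2" by (simp add: a1_def alpha_def beta_def)
  then show "jacobian (\<lambda>X. dexp X *v Z) (at 0) = - (1 / 2) *\<^sub>R ad Z"
    using jacobian_dexp [of Z 0] by (simp add: jac_form_at_0)
  have "beta 0 \<noteq> 0" by (simp add: beta_def)
  then show "jacobian (\<lambda>X. dexp_inv X *v Z) (at 0) = (1 / 2) *\<^sub>R ad Z"
    using jacobian_dexp_inv [of 0 Z] by (simp add: jac_form_at_0 b1_def)
qed (rule jacobian_dexp_tendsto jacobian_dexp_inv_tendsto)+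

end
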